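(* Let $X$ be an infinite-dimensional complex Banach space and $T\in L(X)$. The following conditions are equivalent: (i) there exists a pair $(M,N)$ of closed $T$-invariant subspaces with $X=M\oplus N$ such that $T_M$ is bounded below and $T_N$ is Riesz; (ii) $T$ admits a GKRD and $0\notin\operatorname{int}\sigma_{ap}(T)$; (iii) $T$ admits a GKRD and $T$ has the SVEP at $0$; (iv) there exists a pair $(M,N)$ of closed $T$-invariant subspaces with $X=M\oplus N$ such that $T_M$ is upper semi-Browder and $T_N$ is Riesz; (v) $T$ admits a GKRD and $0\notin\operatorname{acc}\sigma_{\mathcal B_+}(T)$; (vi) $T$ admits a GKRD and $0\notin\operatorname{int}\sigma_{\mathcal B_+}(T)$; (vii) there exists a bounded projection $P$ on $X$ commuting with $T$ such that $T+P$ is upper semi-Browder and $TP$ is Riesz.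
   Context: $L(X)$ is the algebra of bounded operators on $X$. $S$ is Kato if $R(S)$ is closed and $N(S)\subset R(S^n)$ for all $n\in\mathbb N$. $S$ is Riesz if $S-\lambda$ is Fredholm for all $\lambda\ne0$. $S$ is bounded below if injective with closed range. $S$ is upper semi-Fredholm if $\dim N(S)<\infty$ and $R(S)$ closed, and upper semi-Browder if moreover it has finite ascent. For closed $T$-invariant $M,N$ with $X=M\oplus N$, $T_M,T_N$ are the restrictions; $T$ admits a GKRD if there is such a pair with $T_M$ Kato and $T_N$ Riesz. $\sigma_{ap}(T)=\{\lambda: T-\lambda \text{ not bounded below}\}$, $\sigma_{\mathcal B_+}(T)=\{\lambda: T-\lambda\text{ not upper semi-Browder}\}$; $\operatorname{int}$, $\operatorname{acc}$ denote interior and accumulation points. $T$ has the SVEP at $\lambda_0$ if for every open disc $D$ centered at $\lambda_0$ the only analytic $f:D\to X$ with $(T-\lambda)f(\lambda)=0$ on $D$ is $f\equiv0$. *)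

theory Defs
  imports "HOL-Analysis.Analysis"
begin

class complex_banach = banach +
  fixes cscale :: "complex \<Rightarrow> 'a \<Rightarrow> 'a"
  assumes cscale_add_right: "cscale a (x + y) = cscale a x + cscale a y"
    and cscale_add_left: "cscale (a + b) x = cscale a x + cscale b x"
    and cscale_cscale: "cscale a (cscale b x) = cscale (a * b) x"
    and cscale_one: "cscale 1 x = x"
    and cscale_of_real: "cscale (complex_of_real r) x = scaleR r x"
    and norm_cscale: "norm (cscale a x) = cmod a * norm x"

definition clinear_op :: "('a::complex_banach \<Rightarrow> 'a) \<Rightarrow> bool" where
  "clinear_op T \<longleftrightarrow> (\<forall>x y. T (x + y) = T x + T y) \<and> (\<forall>c x. T (cscale c x) = cscale c (T x))"

definition bounded_op :: "('a::complex_banach \<Rightarrow> 'a) \<Rightarrow> bool" where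
  "bounded_op T \<longleftrightarrow> clinear_op T \<and> (\<exists>K. \<forall>x. norm (T x) \<le> norm x * K)"

definition csubspace :: "'a::complex_banach set \<Rightarrow> bool" where
  "csubspace S \<longleftrightarrow> 0 \<in> S \<and> (\<forall>x\<in>S. \<forall>y\<in>S. x + y \<in> S) \<and> (\<forall>c. \<forall>x\<in>S. cscale c x \<in> S)"

definition cspan :: "'a::complex_banach set \<Rightarrow> 'a set" where
  "cspan F = {x. \<exists>c. x = (\<Sum>v\<in>F. cscale (c v) v)}"

definition fin_dim :: "'a::complex_banach set \<Rightarrow> bool" where
  "fin_dim S \<longleftrightarrow> (\<exists>F. finite F \<and> S \<subseteq> cspan F)"

definition closed_subspace :: "'a::complex_banach set \<Rightarrow> bool" where
  "closed_subspace S \<longleftrightarrow> csubspace S \<and> closed S"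

definition kernel_on :: "'a::complex_banach set \<Rightarrow> ('a \<Rightarrow> 'a) \<Rightarrow> 'a set" where
  "kernel_on M T = {x \<in> M. T x = 0}"

text \<open>Properties of the restriction T_M of T to an invariant closed subspace M.\<close>
definition bounded_below_on :: "'a::complex_banach set \<Rightarrow> ('a \<Rightarrow> 'a) \<Rightarrow> bool" where
  "bounded_below_on M T \<longleftrightarrow> inj_on T M \<and> closed (T ` M)"

definition upper_semi_fredholm_on :: "'a::complex_banach set \<Rightarrow> ('a \<Rightarrow> 'a) \<Rightarrow> bool" where
  "upper_semi_fredholm_on M T \<longleftrightarrow> fin_dim (kernel_on M T) \<and> closed (T ` M)"

definition finite_ascent_on :: "'a::complex_banach set \<Rightarrow> ('a \<Rightarrow> 'a) \<Rightarrow> bool" where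
  "finite_ascent_on M T \<longleftrightarrow> (\<exists>p. kernel_on M (T ^^ p) = kernel_on M (T ^^ Suc p))"

definition upper_semi_browder_on :: "'a::complex_banach set \<Rightarrow> ('a \<Rightarrow> 'a) \<Rightarrow> bool" where
  "upper_semi_browder_on M T \<longleftrightarrow> upper_semi_fredholm_on M T \<and> finite_ascent_on M T"

definition fredholm_on :: "'a::complex_banach set \<Rightarrow> ('a \<Rightarrow> 'a) \<Rightarrow> bool" where
  "fredholm_on N S \<longleftrightarrow> fin_dim (kernel_on N S) \<and> closed (S ` N) \<and>
     (\<exists>F. finite F \<and> F \<subseteq> N \<and> N \<subseteq> {y + z | y z. y \<in> S ` N \<and> z \<in> cspan F})"

definition shift_op :: "('a::complex_banach \<Rightarrow> 'a) \<Rightarrow> complex \<Rightarrow> 'a \<Rightarrow> 'a" where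
  "shift_op T mu = (\<lambda>x. T x - cscale mu x)"

definition riesz_on :: "'a::complex_banach set \<Rightarrow> ('a \<Rightarrow> 'a) \<Rightarrow> bool" where
  "riesz_on N T \<longleftrightarrow> (\<forall>mu. mu \<noteq> 0 \<longrightarrow> fredholm_on N (shift_op T mu))"

definition kato_on :: "'a::complex_banach set \<Rightarrow> ('a \<Rightarrow> 'a) \<Rightarrow> bool" where
  "kato_on M T \<longleftrightarrow> closed (T ` M) \<and> (\<forall>n::nat. kernel_on M T \<subseteq> (T ^^ n) ` M)"

definition reducing_pair :: "('a::complex_banach \<Rightarrow> 'a) \<Rightarrow> 'a set \<Rightarrow> 'a set \<Rightarrow> bool" where
  "reducing_pair T M N \<longleftrightarrow> closed_subspace M \<and> closed_subspace N \<and> M \<inter> N = {0} \<and>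
     (\<forall>x. \<exists>m\<in>M. \<exists>n\<in>N. x = m + n) \<and> T ` M \<subseteq> M \<and> T ` N \<subseteq> N"

definition admits_GKRD :: "('a::complex_banach \<Rightarrow> 'a) \<Rightarrow> bool" where
  "admits_GKRD T \<longleftrightarrow> (\<exists>M N. reducing_pair T M N \<and> kato_on M T \<and> riesz_on N T)"

definition sigma_ap :: "('a::complex_banach \<Rightarrow> 'a) \<Rightarrow> complex set" where
  "sigma_ap T = {mu. \<not> bounded_below_on UNIV (shift_op T mu)}"

definition sigma_B_plus :: "('a::complex_banach \<Rightarrow> 'a) \<Rightarrow> complex set" where
  "sigma_B_plus T = {mu. \<not> upper_semi_browder_on UNIV (shift_op T mu)}"

definition c_analytic_on :: "(complex \<Rightarrow> 'a::complex_banach) \<Rightarrow> complex set \<Rightarrow> bool" where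
  "c_analytic_on f D \<longleftrightarrow> (\<forall>z\<in>D. \<exists>v. (f has_derivative (\<lambda>h. cscale h v)) (at z))"

definition SVEP_at :: "('a::complex_banach \<Rightarrow> 'a) \<Rightarrow> complex \<Rightarrow> bool" where
  "SVEP_at T mu0 \<longleftrightarrow> (\<forall>r>0. \<forall>f. c_analytic_on f (ball mu0 r) \<and>
      (\<forall>mu\<in>ball mu0 r. shift_op T mu (f mu) = 0) \<longrightarrow> (\<forall>mu\<in>ball mu0 r. f mu = 0))"

end

theory Submission
  imports Defs "HOL-Complex_Analysis.Complex_Analysis"
begin

text \<open>Every condition is compared with (i). If \<open>T\<^sub>M\<close> is Kato and not injective, then a nonzero
  \<open>x\<^sub>0 \<in> N(T\<^sub>M)\<close> has an infinite backward orbit \<open>T x\<^sub>n\<^sub>+\<^sub>1 = x\<^sub>n\<close> of geometric growth, because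
  \<open>N(T\<^sub>M) \<subseteq> R\<^sup>\<infinity>(T\<^sub>M)\<close>; the power series \<open>\<Sum> \<lambda>\<^sup>n x\<^sub>n\<close> is then an analytic family of eigenvectors near
  \<open>0\<close>. This contradicts the SVEP and puts \<open>0\<close> in the interior of both spectra, so (ii), (iii) and (vi)
  each give (i). In the other direction, the same power series on the hyperrange shows that for an upper
  semi-Fredholm \<open>S\<close> the operators \<open>S - \<lambda>\<close> are either all injective or all noninjective for small
  \<open>\<lambda> \<noteq> 0\<close>; by connectedness of the punctured plane the nonzero eigenvalues of a Riesz operator
  are isolated, and \<open>T\<^sub>N - \<lambda>\<close> has finite ascent. Finally, an upper semi-Browder operator is the direct
  sum of a bounded below operator and a nilpotent one on a finite-dimensional space, which is
  absorbed into the Riesz part.\<close>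

section \<open>The open mapping theorem and the Hahn--Banach theorem\<close>

text \<open>The obstacle is the Riesz summand: \<open>T\<close> on \<open>N\<close> may have
  eigenvalues arbitrarily close to 0, so for that summand nothing can be claimed at 0 or on a whole
  disc around it. The implications out of (i) therefore work at small nonzero points, and those to
  (ii) and (iii) at points that also avoid the eigenvalues of the summand. Index theory is replaced
  by one criterion, N(S) \<inter> R^infinity(S) = {0}. For finite-dimensional N(S) it is equivalent
  to finite ascent; it passes to direct sums componentwise; and for an upper semi-Fredholm S it
  decides which of the two alternatives holds for S - z near z = 0. Restrictions have no types of
  their own, so the analytic tools are stated relative to closed subspaces. Functionals enter only
  twice: in the complement of a Jordan chain and in the identity theorem for vector-valued analytic
  functions.\<close>

text \<open>The domain and the image are both closed, hence complete, so Baire's theorem applies in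
  the subspace topology of the image. The norm bound is what matters later: it yields backward
  orbits of geometric growth and lower bounds for injective operators.\<close>

lemma open_mapping_on:
  fixes f :: "'b::banach \<Rightarrow> 'c::banach"
  assumes f: "bounded_linear f" and M: "subspace M" "closed M" and cl: "closed (f ` M)"
  obtains C where "C > 0" "\<And>y. y \<in> f ` M \<Longrightarrow> \<exists>x\<in>M. f x = y \<and> norm x \<le> C * norm y"
proof -
  interpret f: bounded_linear f by fact
  define Y where "Y = f ` M"
  have subY: "subspace Y"
    unfolding Y_def using M(1) f.linear linear_subspace_image by blast
  have clY: "closed Y" using cl by (simp add: Y_def)
  define A where "A n = closure (f ` (M \<inter> cball 0 (real n)))" for n
  have A_sub: "A n \<subseteq> Y" for n
    unfolding A_def Y_def using cl by (intro closure_minimal) auto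
  have cov: "(\<Union>n. A n) = Y"
  proof
    show "Y \<subseteq> (\<Union>n. A n)"
    proof
      fix y assume "y \<in> Y"
      then obtain x where x: "x \<in> M" "y = f x" by (auto simp: Y_def)
      obtain n where "norm x \<le> real n" using real_arch_simple by blast
      with x have "y \<in> f ` (M \<inter> cball 0 (real n))" by auto
      then have "y \<in> A n" unfolding A_def by (rule subsetD[OF closure_subset])
      then show "y \<in> (\<Union>n. A n)" by blast
    qed
    show "(\<Union>n. A n) \<subseteq> Y" using A_sub by blast
  qed
  obtain n y0 where y0: "y0 \<in> (top_of_set Y) interior_of A n"
  proof -
    have "completely_metrizable_space (top_of_set Y)"
      using clY completely_metrizable_space_closedin completely_metrizable_space_euclidean
      by (metis closed_closedin)
    moreover have "(top_of_set Y) interior_of (\<Union>(range A)) = Y"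
      using cov interior_of_topspace[of "top_of_set Y"] by simp
    moreover have "Y \<noteq> {}" using subY subspace_0 by blast
    moreover have "closedin (top_of_set Y) (A n)" for n
      unfolding A_def using A_sub[of n] by (simp add: A_def closed_subset)
    ultimately have "\<exists>n. (top_of_set Y) interior_of A n \<noteq> {}"
      using Baire_category_alt[of "top_of_set Y" "range A"] by force
    then show ?thesis using that by blast
  qed
  have "openin (top_of_set Y) ((top_of_set Y) interior_of A n)" by simp
  then obtain r where r: "r > 0" "ball y0 r \<inter> Y \<subseteq> (top_of_set Y) interior_of A n"
    using y0 by (meson openin_contains_ball)
  then have r': "ball y0 r \<inter> Y \<subseteq> A n"
    using interior_of_subset by fastforce
  have y0Y: "y0 \<in> Y" using y0 interior_of_subset A_sub by fastforce
  \<comment> \<open>The inner point \<open>y0\<close> of \<open>A n\<close> need not be 0.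
    Subtracting approximations of \<open>y0 + y\<close> and of \<open>y0\<close> moves the ball to
    the origin and doubles the bound on preimages.\<close>
  have approx: "\<exists>x\<in>M. norm x \<le> 2 * real n \<and> norm (y - f x) < e"
    if y: "y \<in> Y" "norm y < r" and e: "e > 0" for y e
  proof -
    have "y0 + y \<in> A n"
      using r' y y0Y subY by (auto simp: subset_iff dist_norm subspace_add)
    then have "\<exists>z\<in>f ` (M \<inter> cball 0 (real n)). dist z (y0 + y) < e/2"
      unfolding A_def closure_approachable using e half_gt_zero by blast
    then obtain x1 where x1: "x1 \<in> M" "norm x1 \<le> real n" "dist (f x1) (y0 + y) < e/2"
      by auto
    have "y0 \<in> A n" using r' y0Y r(1) by auto
    then have "\<exists>z\<in>f ` (M \<inter> cball 0 (real n)). dist z y0 < e/2"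
      unfolding A_def closure_approachable using e half_gt_zero by blast
    then obtain x2 where x2: "x2 \<in> M" "norm x2 \<le> real n" "dist (f x2) y0 < e/2"
      by auto
    have "x1 - x2 \<in> M" using x1 x2 M(1) by (simp add: subspace_diff)
    moreover have "norm (x1 - x2) \<le> 2 * real n"
      using norm_triangle_ineq4[of x1 x2] x1(2) x2(2) by linarith
    moreover have "norm (y - f (x1 - x2)) < e"
    proof -
      have "y - f (x1 - x2) = (y0 + y - f x1) - (y0 - f x2)" by (simp add: f.diff)
      also have "norm \<dots> \<le> norm (y0 + y - f x1) + norm (y0 - f x2)" by (rule norm_triangle_ineq4)
      also have "\<dots> < e" using x1(3) x2(3) by (simp add: dist_norm norm_minus_commute)
      finally show ?thesis .
    qed
    ultimately show ?thesis by blast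
  qed
  \<comment> \<open>Scaling y to norm r/2, where \<open>approx\<close> applies, and back turns the
    bound 2n into 4n/r times the norm of y; the added 1 keeps \<open>C\<close> positive when n =
    0.\<close>
  define C where "C = 4 * (real n + 1) / r"
  have Cpos: "C > 0" using r by (simp add: C_def)
  have step: "\<exists>x\<in>M. norm x \<le> C * norm y \<and> norm (y - f x) \<le> norm y / 2" if y: "y \<in> Y" for y
  proof (cases "y = 0")
    case True
    then show ?thesis using M(1) subspace_0 by (intro bexI[of _ 0]) (auto simp: f.zero)
  next
    case False
    define t where "t = r / (2 * norm y)"
    have t: "t > 0" using False r by (simp add: t_def)
    have tn: "norm (t *\<^sub>R y) < r" using False r by (simp add: t_def)
    have "t *\<^sub>R y \<in> Y" using y subY by (simp add: subspace_scale)
    with approx[of "t *\<^sub>R y" "t * norm y / 2"] tn t False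
    obtain x where x: "x \<in> M" "norm x \<le> 2 * real n" "norm (t *\<^sub>R y - f x) < t * norm y / 2"
      by auto
    have "(1/t) *\<^sub>R x \<in> M" using x M(1) by (simp add: subspace_scale)
    moreover have "norm ((1/t) *\<^sub>R x) \<le> C * norm y"
    proof -
      have "norm ((1/t) *\<^sub>R x) = norm x / t" using t by simp
      also have "\<dots> \<le> (2 * (real n + 1)) / t" using x t by (intro divide_right_mono) auto
      also have "\<dots> = C * norm y" using r False by (simp add: t_def C_def)
      finally show ?thesis .
    qed
    moreover have "norm (y - f ((1/t) *\<^sub>R x)) \<le> norm y / 2"
    proof -
      have "y - f ((1/t) *\<^sub>R x) = (1/t) *\<^sub>R (t *\<^sub>R y - f x)"
        using t by (simp add: f.scaleR scaleR_diff_right)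
      then have "norm (y - f ((1/t) *\<^sub>R x)) = norm (t *\<^sub>R y - f x) / t" using t by simp
      also have "\<dots> \<le> (t * norm y / 2) / t" using x t by (intro divide_right_mono) auto
      finally show ?thesis using t by simp
    qed
    ultimately show ?thesis by blast
  qed
  then obtain g where g: "\<And>y. y \<in> Y \<Longrightarrow> g y \<in> M"
    "\<And>y. y \<in> Y \<Longrightarrow> norm (g y) \<le> C * norm y" "\<And>y. y \<in> Y \<Longrightarrow> norm (y - f (g y)) \<le> norm y / 2"
    by metis
  have "\<exists>x\<in>M. f x = y \<and> norm x \<le> (2 * C) * norm y" if y: "y \<in> Y" for y
  proof -
    \<comment> \<open>\<open>u k\<close> is the residual after k corrections. It halves each time,
      so the corrections \<open>g (u k)\<close> sum to an exact preimage at the cost of a factor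
      2.\<close>
    define u where "u k = ((\<lambda>z. z - f (g z)) ^^ k) y" for k
    have u0: "u 0 = y" and uS: "u (Suc k) = u k - f (g (u k))" for k by (simp_all add: u_def)
    have uY: "u k \<in> Y" for k
    proof (induction k)
      case (Suc k)
      then show ?case using g(1) subY unfolding uS by (auto intro!: subspace_diff simp: Y_def)
    qed (simp add: u0 y)
    have un: "norm (u k) \<le> norm y * (1/2)^k" for k
    proof (induction k)
      case (Suc k)
      have "norm (u (Suc k)) \<le> norm (u k) / 2" using g(3)[OF uY] uS by simp
      then show ?case using Suc by simp
    qed (simp add: u0)
    have gn: "norm (g (u k)) \<le> C * norm y * (1/2)^k" for k
    proof -
      have "norm (g (u k)) \<le> C * norm (u k)" using g(2)[OF uY] .
      also have "\<dots> \<le> C * (norm y * (1/2)^k)" using un Cpos by (intro mult_left_mono) auto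
      finally show ?thesis by (simp add: mult.assoc)
    qed
    have geo: "summable (\<lambda>k. C * norm y * (1/2::real)^k)"
      by (intro summable_mult summable_geometric) simp
    have sm: "summable (\<lambda>k. norm (g (u k)))"
      by (rule summable_comparison_test'[OF geo, of 0]) (use gn in auto)
    define x where "x = (\<Sum>k. g (u k))"
    have sums: "(\<lambda>k. g (u k)) sums x"
      unfolding x_def using summable_norm_cancel[OF sm] by (rule summable_sums)
    have "x \<in> M"
    proof (rule Lim_in_closed_set[OF M(2)])
      show "(\<lambda>n. \<Sum>k<n. g (u k)) \<longlonglongrightarrow> x" using sums by (simp add: sums_def)
      show "\<forall>\<^sub>F n in sequentially. (\<Sum>k<n. g (u k)) \<in> M"
        using g(1) uY M(1) by (auto intro!: always_eventually subspace_sum)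
    qed simp
    moreover have "f x = y"
    proof -
      have "(\<lambda>k. f (g (u k))) sums f x" using sums f.sums by blast
      moreover have "(\<lambda>k. f (g (u k))) = (\<lambda>k. u k - u (Suc k))" by (simp add: uS)
      moreover have "(\<lambda>k. u k - u (Suc k)) sums (u 0 - 0)"
      proof (rule telescope_sums')
        have "(\<lambda>k. norm y * (1/2::real)^k) \<longlonglongrightarrow> norm y * 0"
          by (intro tendsto_mult tendsto_const LIMSEQ_realpow_zero) auto
        then have "(\<lambda>k. norm y * (1/2::real)^k) \<longlonglongrightarrow> 0" by simp
        moreover have "\<forall>\<^sub>F k in sequentially. norm (u k) \<le> norm y * (1/2)^k" using un by simp
        ultimately show "u \<longlonglongrightarrow> 0" by (rule Lim_null_comparison[rotated])
      qed
      ultimately show ?thesis using sums_unique2 u0 by fastforce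
    qed
    moreover have "norm x \<le> (2 * C) * norm y"
    proof -
      have "norm x \<le> (\<Sum>k. norm (g (u k)))" unfolding x_def by (rule summable_norm[OF sm])
      also have "\<dots> \<le> (\<Sum>k. C * norm y * (1/2::real)^k)"
        by (rule suminf_le[OF gn sm geo])
      also have "\<dots> = C * norm y * 2" by (subst suminf_mult) (auto simp: suminf_geometric)
      finally show ?thesis by simp
    qed
    ultimately show ?thesis by blast
  qed
  with Cpos show thesis by (intro that[of "2 * C"]) (auto simp: Y_def)
qed

text \<open>A pointwise minimal element among the sublinear functionals is linear, which gives the
  Hahn--Banach theorem from Zorn's lemma without extending functionals one dimension at a time.\<close>

definition sublinear :: "('b::real_vector \<Rightarrow> real) \<Rightarrow> bool" where
  "sublinear q \<longleftrightarrow> (\<forall>x y. q (x + y) \<le> q x + q y) \<and> (\<forall>t x. t \<ge> 0 \<longrightarrow> q (t *\<^sub>R x) = t * q x)"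

lemma sublinear_zero: "sublinear q \<Longrightarrow> q 0 = 0"
  unfolding sublinear_def by (metis mult_zero_left order_refl scaleR_zero_left)

lemma sublinear_minus: "sublinear q \<Longrightarrow> - q (- x) \<le> q x"
proof -
  assume q: "sublinear q"
  have "q (x + - x) \<le> q x + q (- x)" using q unfolding sublinear_def by blast
  then show ?thesis using sublinear_zero[OF q] by simp
qed

text \<open>The witness is the infimum over t \<ge> 0 of q(x + t y) - t q(y), finite because -q(-x)
  is a lower bound. Applied to a minimal q it forces q(-y) = -q(y), the missing half of
  linearity.\<close>

lemma sublinear_reduce:
  fixes q :: "'b::real_vector \<Rightarrow> real"
  assumes q: "sublinear q"
  obtains q' where "sublinear q'" "q' \<le> q" "q' (- y) \<le> - q y"
proof -
  define S where "S x = (\<lambda>t. q (x + t *\<^sub>R y) - t * q y) ` {0..}" for x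
  define q' where "q' x = Inf (S x)" for x
  have add: "q (a + b) \<le> q a + q b" for a b using q by (simp add: sublinear_def)
  have hom: "t \<ge> 0 \<Longrightarrow> q (t *\<^sub>R x) = t * q x" for t x using q by (simp add: sublinear_def)
  have lower: "- q (- x) \<le> s" if "s \<in> S x" for s x
  proof -
    from that obtain t where t: "t \<ge> 0" "s = q (x + t *\<^sub>R y) - t * q y" by (auto simp: S_def)
    have "q (t *\<^sub>R y) \<le> q (x + t *\<^sub>R y) + q (- x)" using add[of "x + t *\<^sub>R y" "- x"] by simp
    then show ?thesis using t hom by simp
  qed
  have bdd: "bdd_below (S x)" for x using lower by (meson bdd_below.I)
  have ne: "S x \<noteq> {}" for x by (auto simp: S_def)
  have le: "q' x \<le> q (x + t *\<^sub>R y) - t * q y" if "t \<ge> 0" for x t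
    unfolding q'_def by (rule cInf_lower[OF _ bdd]) (use that in \<open>auto simp: S_def\<close>)
  have ge: "c \<le> q' x" if "\<And>t. t \<ge> 0 \<Longrightarrow> c \<le> q (x + t *\<^sub>R y) - t * q y" for c x
    unfolding q'_def by (rule cInf_greatest[OF ne]) (use that in \<open>auto simp: S_def\<close>)
  have q'0: "q' 0 = 0"
  proof (rule antisym)
    show "q' 0 \<le> 0" using le[of 0 0] sublinear_zero[OF q] by simp
    show "0 \<le> q' 0" by (rule ge) (simp add: hom)
  qed
  have hle: "t * q' x \<le> q' (t *\<^sub>R x)" if t: "t > 0" for t x
  proof (rule ge)
    fix s :: real assume s: "s \<ge> 0"
    have "q' x \<le> q (x + (s/t) *\<^sub>R y) - (s/t) * q y" using le[of "s/t"] s t by simp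
    then have "t * q' x \<le> t * (q (x + (s/t) *\<^sub>R y) - (s/t) * q y)" using t by simp
    also have "\<dots> = t * q (x + (s/t) *\<^sub>R y) - s * q y" using t by (simp add: field_simps)
    also have "\<dots> = q (t *\<^sub>R x + s *\<^sub>R y) - s * q y"
      using hom[of t "x + (s/t) *\<^sub>R y"] t by (simp add: scaleR_add_right)
    finally show "t * q' x \<le> q (t *\<^sub>R x + s *\<^sub>R y) - s * q y" .
  qed
  have sub: "sublinear q'"
    unfolding sublinear_def
  proof (intro conjI allI impI)
    fix x z
    \<comment> \<open>The two infima are taken one after the other: with \<open>t\<close> fixed, the
      infimum over \<open>s\<close> produces \<open>q' x\<close>; the infimum over \<open>t\<close>
      follows.\<close>
    have "q' (x + z) - (q (z + t *\<^sub>R y) - t * q y) \<le> q' x" if t: "t \<ge> 0" for t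
    proof (rule ge)
      fix s :: real assume s: "s \<ge> 0"
      have "q' (x + z) \<le> q (x + z + (s + t) *\<^sub>R y) - (s + t) * q y" using le s t by simp
      also have "q (x + z + (s + t) *\<^sub>R y) \<le> q (x + s *\<^sub>R y) + q (z + t *\<^sub>R y)"
        using add[of "x + s *\<^sub>R y" "z + t *\<^sub>R y"] by (simp add: scaleR_add_left algebra_simps)
      finally show "q' (x + z) - (q (z + t *\<^sub>R y) - t * q y) \<le> q (x + s *\<^sub>R y) - s * q y"
        by (simp add: algebra_simps)
    qed
    then have "q' (x + z) - q' x \<le> q' z" by (intro ge) (simp add: algebra_simps)
    then show "q' (x + z) \<le> q' x + q' z" by simp
  next
    fix t :: real and x assume t: "t \<ge> 0"
    show "q' (t *\<^sub>R x) = t * q' x"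
    proof (cases "t = 0")
      case False
      then have t: "t > 0" using t by simp
      have "(1/t) * q' (t *\<^sub>R x) \<le> q' ((1/t) *\<^sub>R (t *\<^sub>R x))" using hle[of "1/t" "t *\<^sub>R x"] t by simp
      then have "q' (t *\<^sub>R x) \<le> t * q' x" using t by (simp add: field_simps)
      then show ?thesis using hle[OF t, of x] by simp
    qed (simp add: q'0)
  qed
  moreover have "q' \<le> q" using le[of 0] by (auto simp: le_fun_def)
  moreover have "q' (- y) \<le> - q y" using le[of 1 "- y"] sublinear_zero[OF q] by simp
  ultimately show thesis by (rule that)
qed

text \<open>Zorn's lemma is used with the order reversed, so the bound of a chain is its pointwise
  infimum. It is finite because every member is at least -p(-x), and subadditive because the smaller
  of two members can serve for both summands.\<close>

lemma minimal_sublinear_exists: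
  fixes p :: "'b::real_vector \<Rightarrow> real"
  assumes p: "sublinear p"
  obtains q where "sublinear q" "q \<le> p" "\<And>q'. sublinear q' \<Longrightarrow> q' \<le> q \<Longrightarrow> q' = q"
proof -
  define A where "A = {q. sublinear q \<and> q \<le> p}"
  have "\<exists>m\<in>A. \<forall>a\<in>A. a \<le> m \<longrightarrow> a = m"
  proof (rule predicate_Zorn)
    show "partial_order_on A (relation_of (\<lambda>x y. y \<le> x) A)"
      by (rule partial_order_on_relation_ofI) auto
    fix C assume C: "C \<in> Chains (relation_of (\<lambda>x y. y \<le> x) A)"
    then have CA: "C \<subseteq> A" and tot: "\<And>a b. a \<in> C \<Longrightarrow> b \<in> C \<Longrightarrow> a \<le> b \<or> b \<le> a"
      unfolding Chains_def relation_of_def by auto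
    show "\<exists>u\<in>A. \<forall>a\<in>C. u \<le> a"
    proof (cases "C = {}")
      case True
      then show ?thesis using p by (auto simp: A_def)
    next
      case False
      define u where "u x = Inf ((\<lambda>q. q x) ` C)" for x
      have slq: "sublinear q" if "q \<in> C" for q using that CA by (auto simp: A_def)
      have lower: "- p (- x) \<le> q x" if "q \<in> C" for q x
      proof -
        have "q (- x) \<le> p (- x)" using that CA by (auto simp: A_def le_fun_def)
        then show ?thesis using sublinear_minus[OF slq[OF that], of x] by linarith
      qed
      have le: "u x \<le> q x" if "q \<in> C" for q x
        unfolding u_def by (rule cInf_lower) (use that lower in \<open>auto intro!: bdd_belowI\<close>)
      have ge: "c \<le> u x" if "\<And>q. q \<in> C \<Longrightarrow> c \<le> q x" for c x
        unfolding u_def by (rule cInf_greatest) (use that False in auto)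
      have "sublinear u"
        unfolding sublinear_def
      proof (intro conjI allI impI)
        fix x y
        have *: "u (x + y) \<le> q x + q' y" if qq: "q \<in> C" "q' \<in> C" for q q'
        proof -
          obtain m where m: "m \<in> C" "m \<le> q" "m \<le> q'" using tot[OF qq] qq by blast
          have "u (x + y) \<le> m (x + y)" using le m by blast
          also have "\<dots> \<le> m x + m y" using slq[OF m(1)] by (simp add: sublinear_def)
          also have "\<dots> \<le> q x + q' y" using m by (simp add: le_fun_def add_mono)
          finally show ?thesis .
        qed
        have "u (x + y) - q' y \<le> u x" if "q' \<in> C" for q'
          by (rule ge) (use *[OF _ that] in \<open>simp add: algebra_simps\<close>)
        then have "u (x + y) - u x \<le> u y" by (intro ge) (simp add: algebra_simps)
        then show "u (x + y) \<le> u x + u y" by simp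
      next
        fix t :: real and x assume t: "t \<ge> 0"
        have hom: "q (t *\<^sub>R x) = t * q x" if "q \<in> C" "t \<ge> 0" for q t x
          using slq[OF that(1)] that(2) by (simp add: sublinear_def)
        show "u (t *\<^sub>R x) = t * u x"
        proof (cases "t = 0")
          case True
          obtain q where "q \<in> C" using False by blast
          have "u 0 \<le> 0" using le[OF \<open>q \<in> C\<close>, of 0] sublinear_zero[OF slq[OF \<open>q \<in> C\<close>]] by simp
          moreover have "0 \<le> u 0" by (rule ge) (simp add: sublinear_zero slq)
          ultimately show ?thesis using True by simp
        next
          case F: False
          then have t: "t > 0" using t by simp
          have "u (t *\<^sub>R x) / t \<le> u x"
          proof (rule ge)
            fix q assume "q \<in> C"
            then show "u (t *\<^sub>R x) / t \<le> q x" using le[of q "t *\<^sub>R x"] hom t by (simp add: field_simps)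
          qed
          moreover have "t * u x \<le> u (t *\<^sub>R x)"
          proof (rule ge)
            fix q assume q: "q \<in> C"
            have "t * u x \<le> t * q x" using le[OF q, of x] t by simp
            then show "t * u x \<le> q (t *\<^sub>R x)" using hom[OF q, of t x] t by simp
          qed
          ultimately show ?thesis using t by (simp add: field_simps)
        qed
      qed
      moreover have "u \<le> p"
      proof -
        obtain q where q: "q \<in> C" using False by blast
        then have "q \<le> p" using CA by (auto simp: A_def)
        then show ?thesis using le[OF q] by (auto simp: le_fun_def intro: order_trans)
      qed
      ultimately show ?thesis using le by (auto simp: A_def le_fun_def)
    qed
  qed
  then obtain q where q: "q \<in> A" "\<And>a. a \<in> A \<Longrightarrow> a \<le> q \<Longrightarrow> a = q" by blast
  show thesis
  proof (rule that)
    show "q' = q" if "sublinear q'" "q' \<le> q" for q'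
      using q that order_trans by (fastforce simp: A_def)
  qed (use q in \<open>auto simp: A_def\<close>)
qed

text \<open>Lowering p at -v before minimizing fixes the value at v: an odd functional below
  \<open>p'\<close> is at least p(v) there.\<close>

lemma hahn_banach_sublinear:
  fixes p :: "'b::real_vector \<Rightarrow> real"
  assumes p: "sublinear p"
  obtains g where "linear g" "g \<le> p" "g v = p v"
proof -
  obtain p' where p': "sublinear p'" "p' \<le> p" "p' (- v) \<le> - p v"
    using sublinear_reduce[OF p] by blast
  obtain g where g: "sublinear g" "g \<le> p'" "\<And>q. sublinear q \<Longrightarrow> q \<le> g \<Longrightarrow> q = g"
    using minimal_sublinear_exists[OF p'(1)] by blast
  have neg: "g (- y) = - g y" for y
  proof -
    obtain q where "sublinear q" "q \<le> g" "q (- y) \<le> - g y" using sublinear_reduce[OF g(1)] by blast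
    then have "g (- y) \<le> - g y" using g(3) by blast
    then show ?thesis using sublinear_minus[OF g(1), of y] by simp
  qed
  have add: "g (x + y) = g x + g y" for x y
  proof (rule antisym)
    show "g (x + y) \<le> g x + g y" using g(1) by (simp add: sublinear_def)
    have "g (x + y + - y) \<le> g (x + y) + g (- y)" using g(1) unfolding sublinear_def by blast
    then show "g x + g y \<le> g (x + y)" by (simp add: neg)
  qed
  have "g (t *\<^sub>R x) = t * g x" for t x
  proof (cases "t \<ge> 0")
    case False
    then have "g ((- t) *\<^sub>R x) = (- t) * g x"
      using g(1) unfolding sublinear_def by (meson linorder_linear neg_0_le_iff_le)
    then show ?thesis using neg[of "t *\<^sub>R x"] by simp
  qed (use g(1) in \<open>simp add: sublinear_def\<close>)
  then have "linear g" using add by (intro linearI) auto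
  moreover have gp: "g \<le> p" using g(2) p'(2) by (rule order_trans)
  moreover have "g v = p v"
  proof (rule antisym)
    show "g v \<le> p v" using gp by (simp add: le_fun_def)
    have "g (- v) \<le> - p v" using g(2) p'(3) by (metis le_fun_def order_trans)
    then show "p v \<le> g v" by (simp add: neg)
  qed
  ultimately show thesis by (rule that)
qed

text \<open>The distance to Y is a convenient dominating functional: it vanishes on Y, is at most
  the norm, and is positive off Y when Y is closed. Vanishing, boundedness and separation then all
  come from one domination.\<close>

lemma sublinear_infdist:
  fixes Y :: "'b::real_normed_vector set"
  assumes Y: "subspace Y"
  shows "sublinear (\<lambda>x. infdist x Y)"
  unfolding sublinear_def
proof (intro conjI allI impI)
  have ne: "Y \<noteq> {}" using Y subspace_0 by blast
  have ex: "\<exists>a\<in>Y. dist x a < infdist x Y + e" if "e > 0" for x and e :: real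
    using cInf_lessD[of "dist x ` Y" "infdist x Y + e"] that ne by (auto simp: infdist_notempty)
  show "infdist (x + y) Y \<le> infdist x Y + infdist y Y" for x y
  proof (rule field_le_epsilon)
    fix e :: real assume "e > 0"
    then obtain a b where ab: "a \<in> Y" "dist x a < infdist x Y + e/2" "b \<in> Y" "dist y b < infdist y Y + e/2"
      using ex[of "e/2"] by (meson half_gt_zero)
    have "infdist (x + y) Y \<le> dist (x + y) (a + b)" using ab Y by (intro infdist_le) (simp add: subspace_add)
    also have "\<dots> \<le> dist x a + dist y b" by (rule dist_triangle_add)
    finally show "infdist (x + y) Y \<le> infdist x Y + infdist y Y + e" using ab by linarith
  qed
  have le: "infdist (t *\<^sub>R x) Y \<le> t * infdist x Y" if t: "t > 0" for t and x :: 'b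
  proof -
    have "infdist (t *\<^sub>R x) Y / t \<le> dist x a" if "a \<in> Y" for a
    proof -
      have "infdist (t *\<^sub>R x) Y \<le> dist (t *\<^sub>R x) (t *\<^sub>R a)" using that Y by (intro infdist_le) (simp add: subspace_scale)
      also have "\<dots> = t * dist x a" using t by (simp add: dist_norm scaleR_diff_right[symmetric])
      finally show ?thesis using t by (simp add: field_simps)
    qed
    then have "infdist (t *\<^sub>R x) Y / t \<le> infdist x Y"
      using ne by (subst infdist_notempty[of Y x]) (auto intro: cINF_greatest)
    then show ?thesis using t by (simp add: field_simps)
  qed
  show "infdist (t *\<^sub>R x) Y = t * infdist x Y" if "t \<ge> 0" for t and x :: 'b
  proof (cases "t = 0")
    case True
    then show ?thesis using infdist_zero[OF subspace_0[OF Y]] by simp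
  next
    case False
    then have t: "t > 0" using that by simp
    have "infdist ((1/t) *\<^sub>R (t *\<^sub>R x)) Y \<le> (1/t) * infdist (t *\<^sub>R x) Y" using le[of "1/t" "t *\<^sub>R x"] t by simp
    then have "t * infdist x Y \<le> infdist (t *\<^sub>R x) Y" using t by (simp add: field_simps)
    then show ?thesis using le[OF t, of x] by simp
  qed
qed

section \<open>Bounded operators and finite-dimensional subspaces\<close>

text \<open>The class \<open>banach\<close> carries real scalars; this supplies complex span,
  independence and dimension.\<close>

interpretation cvs: vector_space "cscale :: complex \<Rightarrow> 'a::complex_banach \<Rightarrow> 'a"
  by unfold_locales (simp_all add: cscale_add_right cscale_add_left cscale_cscale cscale_one)

lemma csubspace_iff: "csubspace S \<longleftrightarrow> cvs.subspace S"
  by (auto simp: csubspace_def cvs.subspace_def)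

lemma cspan_eq_span: "finite F \<Longrightarrow> cspan F = cvs.span F"
  by (auto simp: cspan_def cvs.span_finite)

lemma csubspace_imp_subspace: "csubspace S \<Longrightarrow> subspace S"
  by (auto simp: csubspace_def subspace_def cscale_of_real[symmetric])

lemma closed_subspace_imp_subspace: "closed_subspace S \<Longrightarrow> subspace S"
  by (simp add: closed_subspace_def csubspace_imp_subspace)

lemma bounded_op_imp_bounded_linear: "bounded_op T \<Longrightarrow> bounded_linear T"
  unfolding bounded_op_def clinear_op_def bounded_linear_def bounded_linear_axioms_def
  by (auto intro!: linearI simp: cscale_of_real[symmetric])

lemma bounded_op_cscale: "bounded_op T \<Longrightarrow> T (cscale c x) = cscale c (T x)"
  by (simp add: bounded_op_def clinear_op_def)

lemma bounded_op_add: "bounded_op T \<Longrightarrow> T (x + y) = T x + T y"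
  by (simp add: bounded_op_def clinear_op_def)

lemma bounded_op_zero: "bounded_op T \<Longrightarrow> T 0 = 0"
  using bounded_op_imp_bounded_linear linear_simps(3) by blast

lemma bounded_op_diff: "bounded_op T \<Longrightarrow> T (x - y) = T x - T y"
  using bounded_op_imp_bounded_linear linear_simps(2) by blast

lemma bounded_op_linear: "bounded_op T \<Longrightarrow> Vector_Spaces.linear cscale cscale T"
  by (intro Vector_Spaces.linear.intro module_hom.intro module_hom_axioms.intro
      cvs.module_axioms cvs.vector_space_axioms)
    (simp_all add: bounded_op_cscale bounded_op_add)

lemma bounded_opI:
  assumes "bounded_linear T" "\<And>c x. T (cscale c x) = cscale c (T x)"
  shows "bounded_op T"
  using assms bounded_linear.bounded linear_simps(1)[OF assms(1)]
  unfolding bounded_op_def clinear_op_def by blast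

lemma cscale_scaleR: "cscale c (r *\<^sub>R x) = r *\<^sub>R cscale c x"
  by (metis cscale_cscale cscale_of_real mult.commute)

lemma bounded_linear_cscale: "bounded_linear (cscale c)"
  by (rule bounded_linear_intro[where K = "cmod c"])
    (simp_all add: cscale_add_right cscale_scaleR norm_cscale)

lemma scaleR_cscale: "cscale (r *\<^sub>R c) x = r *\<^sub>R cscale c x"
  by (metis cscale_cscale cscale_of_real scaleR_conv_of_real)

lemma bounded_linear_cscale_left: "bounded_linear (\<lambda>c. cscale c v)"
  by (rule bounded_linear_intro[where K = "norm v"])
    (simp_all add: cscale_add_left norm_cscale scaleR_cscale)

lemma bounded_op_sum: "bounded_op T \<Longrightarrow> T (sum f A) = (\<Sum>x\<in>A. T (f x))"
  by (rule linear_sum[OF bounded_linear.linear[OF bounded_op_imp_bounded_linear]])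

lemma bounded_op_plus:
  assumes "bounded_op S" "bounded_op T"
  shows "bounded_op (\<lambda>x. S x + T x)"
  by (rule bounded_opI)
    (simp_all add: assms bounded_linear_add bounded_op_imp_bounded_linear bounded_op_cscale cscale_add_right)

lemma bounded_op_compose:
  assumes "bounded_op S" "bounded_op T"
  shows "bounded_op (\<lambda>x. S (T x))"
  by (rule bounded_opI)
    (simp_all add: assms bounded_linear_compose bounded_op_imp_bounded_linear bounded_op_cscale)

lemma bounded_op_shift: "bounded_op T \<Longrightarrow> bounded_op (shift_op T \<mu>)"
  unfolding shift_op_def
  by (rule bounded_opI)
    (simp_all add: bounded_linear_sub bounded_op_imp_bounded_linear bounded_linear_cscale
      bounded_op_cscale cvs.scale_right_diff_distrib mult.commute)

lemma bounded_op_funpow: "bounded_op T \<Longrightarrow> bounded_op (T ^^ n)"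
proof (induction n)
  case 0
  show ?case by (rule bounded_opI) (simp_all add: id_def bounded_linear_ident)
next
  case (Suc n)
  then have "bounded_linear (T \<circ> T ^^ n)"
    using bounded_linear_compose[of T "T ^^ n"] by (simp add: bounded_op_imp_bounded_linear o_def)
  with Suc show ?case by (intro bounded_opI[of "T ^^ Suc n"]) (simp_all add: bounded_op_cscale)
qed

lemma shift_op_shift_op: "shift_op (shift_op T \<mu>) \<nu> = shift_op T (\<mu> + \<nu>)"
  by (simp add: shift_op_def fun_eq_iff cscale_add_left)

lemma csubspace_image: "bounded_op T \<Longrightarrow> csubspace S \<Longrightarrow> csubspace (T ` S)"
  unfolding csubspace_iff
  by (rule module_hom.subspace_image[OF bounded_op_linear[unfolded linear_iff_module_hom]])

lemma csubspace_Int: "csubspace S \<Longrightarrow> csubspace S' \<Longrightarrow> csubspace (S \<inter> S')"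
  by (auto simp: csubspace_def)

lemma csubspace_plus: "csubspace S \<Longrightarrow> csubspace S' \<Longrightarrow> csubspace (S + S')"
  using cvs.subspace_sums unfolding csubspace_iff set_plus_def
  by (smt (verit) Collect_cong)

lemma csubspace_kernel_on: "bounded_op T \<Longrightarrow> csubspace S \<Longrightarrow> csubspace (kernel_on S T)"
  by (auto simp: csubspace_def kernel_on_def bounded_op_zero bounded_op_add bounded_op_cscale)

lemma csubspace_invariant_shift:
  "csubspace S \<Longrightarrow> T ` S \<subseteq> S \<Longrightarrow> shift_op T \<mu> ` S \<subseteq> S"
  unfolding csubspace_iff shift_op_def by (auto intro!: cvs.subspace_diff cvs.subspace_scale)

lemma funpow_invariant: "T ` S \<subseteq> S \<Longrightarrow> (T ^^ n) ` S \<subseteq> S"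
  by (induction n) auto

lemma inj_on_iff_kernel_on:
  assumes "bounded_op T" "csubspace S"
  shows "inj_on T S \<longleftrightarrow> kernel_on S T = {0}"
proof
  assume "inj_on T S"
  then show "kernel_on S T = {0}"
    using assms by (auto simp: kernel_on_def inj_on_def csubspace_def bounded_op_zero)
next
  assume K: "kernel_on S T = {0}"
  show "inj_on T S"
  proof (rule inj_onI)
    fix x y assume "x \<in> S" "y \<in> S" "T x = T y"
    then have "x - y \<in> kernel_on S T"
      using assms cvs.subspace_diff by (auto simp: kernel_on_def csubspace_iff bounded_op_diff)
    then show "x = y" using K by simp
  qed
qed

section \<open>Finite-dimensional subspaces\<close>

lemma fin_dim_iff: "fin_dim S \<longleftrightarrow> (\<exists>F. finite F \<and> S \<subseteq> cvs.span F)"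
  unfolding fin_dim_def using cspan_eq_span by metis

lemma fin_dim_subset: "fin_dim S \<Longrightarrow> S' \<subseteq> S \<Longrightarrow> fin_dim S'"
  by (auto simp: fin_dim_def)

lemma fin_dim_plus: "fin_dim S \<Longrightarrow> fin_dim S' \<Longrightarrow> fin_dim (S + S')"
  unfolding fin_dim_iff
proof (elim exE conjE)
  fix F G assume "finite F" "S \<subseteq> cvs.span F" "finite G" "S' \<subseteq> cvs.span G"
  then show "\<exists>F. finite F \<and> S + S' \<subseteq> cvs.span F"
    by (intro exI[of _ "F \<union> G"]) (auto simp: cvs.span_Un set_plus_def)
qed

lemma fin_dim_basis:
  assumes "fin_dim S" "csubspace S"
  obtains F where "finite F" "S = cvs.span F" "cvs.independent F" "card F = cvs.dim S"
proof -
  obtain G where G: "finite G" "S \<subseteq> cvs.span G" using assms(1) by (auto simp: fin_dim_iff)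
  obtain B where B: "B \<subseteq> S" "cvs.independent B" "S \<subseteq> cvs.span B" "card B = cvs.dim S"
    using cvs.basis_exists by blast
  have "finite B" using cvs.independent_span_bound[OF G(1) B(2)] B(1) G(2) by blast
  moreover have "S = cvs.span B"
    using B assms(2) cvs.span_minimal unfolding csubspace_iff by blast
  ultimately show thesis using B that by blast
qed

lemma fin_dim_psubset_dim:
  assumes "csubspace V" "csubspace W" "fin_dim W" "V \<subset> W"
  shows "cvs.dim V < cvs.dim W"
proof -
  have "fin_dim V" using assms fin_dim_subset by blast
  then obtain B where B: "finite B" "V = cvs.span B" "cvs.independent B" "card B = cvs.dim V"
    using assms fin_dim_basis by blast
  obtain C where C: "finite C" "W = cvs.span C" "cvs.independent C" "card C = cvs.dim W"
    using assms fin_dim_basis by blast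
  obtain w where w: "w \<in> W" "w \<notin> V" using assms by blast
  have "cvs.independent (insert w B)" using B w by (intro cvs.independent_insertI) auto
  moreover have "insert w B \<subseteq> cvs.span C"
    using w assms(4) B(2) C(2) cvs.span_superset by blast
  ultimately have "card (insert w B) \<le> card C"
    using cvs.independent_span_bound[OF C(1)] by blast
  moreover have "w \<notin> B" using w B(2) cvs.span_superset by blast
  ultimately show ?thesis using B C by simp
qed

text \<open>A member of least dimension cannot properly contain a later one. The search starts at
  \<open>n0\<close> because dimensions can be compared only once the members are
  finite-dimensional.\<close>

lemma fin_dim_chain_stabilizes:
  fixes K :: "nat \<Rightarrow> 'a::complex_banach set"
  assumes sub: "\<And>n. csubspace (K n)" and dec: "decseq K" and fin: "fin_dim (K n0)"
  obtains n where "n \<ge> n0" "\<And>m. m \<ge> n \<Longrightarrow> K m = K n"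
proof -
  obtain n where n: "n \<ge> n0" "\<And>m. m \<ge> n0 \<Longrightarrow> cvs.dim (K n) \<le> cvs.dim (K m)"
    using ex_has_least_nat[of "\<lambda>n. n \<ge> n0" n0 "\<lambda>n. cvs.dim (K n)"] by blast
  have "K m = K n" if "m \<ge> n" for m
  proof (rule ccontr)
    assume "K m \<noteq> K n"
    then have "K m \<subset> K n" using dec that by (auto simp: decseq_def)
    moreover have "fin_dim (K n)" using fin_dim_subset[OF fin] n(1) dec by (simp add: decseq_def)
    ultimately have "cvs.dim (K m) < cvs.dim (K n)" using fin_dim_psubset_dim[OF sub sub] by blast
    moreover have "m \<ge> n0" using n(1) that by simp
    ultimately show False using n(2)[of m] by simp
  qed
  then show thesis using that n(1) by blast
qed

section \<open>Finite-dimensional extensions of closed subspaces, and separation\<close>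

text \<open>For v outside Y the norm of y + c v is at least |c| times the distance from v to Y.
  Coefficients along a convergent sequence are thus bounded; a subsequence of them converges, and
  with it the components in Y.\<close>

lemma closed_plus_line:
  fixes v :: "'a::complex_banach"
  assumes Y: "closed_subspace Y"
  shows "closed (Y + range (\<lambda>c. cscale c v))"
proof (cases "v \<in> Y")
  case True
  have "Y + range (\<lambda>c. cscale c v) = Y"
  proof
    show "Y + range (\<lambda>c. cscale c v) \<subseteq> Y"
      using True Y by (auto simp: set_plus_def closed_subspace_def csubspace_def)
    show "Y \<subseteq> Y + range (\<lambda>c. cscale c v)"
    proof
      fix y assume "y \<in> Y"
      moreover have "0 \<in> range (\<lambda>c. cscale c v)" by (metis cvs.scale_zero_left rangeI)
      ultimately have "y + 0 \<in> Y + range (\<lambda>c. cscale c v)" by (rule set_plus_intro)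
      then show "y \<in> Y + range (\<lambda>c. cscale c v)" by simp
    qed
  qed
  then show ?thesis using Y by (simp add: closed_subspace_def)
next
  case False
  have sub: "cvs.subspace Y" and cl: "closed Y"
    using Y by (auto simp: closed_subspace_def csubspace_iff)
  define d where "d = infdist v Y"
  have d: "d > 0" unfolding d_def
    using infdist_pos_not_in_closed[OF cl _ False] cvs.subspace_0[OF sub] by blast
  have lb: "d * cmod c \<le> norm (y + cscale c v)" if "y \<in> Y" for c y
  proof (cases "c = 0")
    case False
    have "cscale (- inverse c) y \<in> Y" using sub that cvs.subspace_scale by blast
    then have "d \<le> dist v (cscale (- inverse c) y)" unfolding d_def by (rule infdist_le)
    also have "\<dots> = norm (cscale (inverse c) (y + cscale c v))"
      using False by (simp add: dist_norm cscale_add_right cscale_cscale cscale_one add.commute)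
    also have "\<dots> = norm (y + cscale c v) / cmod c"
      by (simp add: norm_cscale norm_inverse divide_inverse mult.commute)
    finally show ?thesis using False by (simp add: field_simps)
  qed simp
  show ?thesis
    unfolding closed_sequential_limits
  proof (intro allI impI, elim conjE)
    fix s l assume s: "\<forall>n. s n \<in> Y + range (\<lambda>c. cscale c v)" and lim: "s \<longlonglongrightarrow> l"
    have "\<exists>y c. y \<in> Y \<and> s n = y + cscale c v" for n
      using s by (fastforce simp: set_plus_def)
    then obtain y c where yc: "\<And>n. y n \<in> Y" "\<And>n. s n = y n + cscale (c n) v" by metis
    have bnd: "bounded (range c)"
    proof -
      obtain B where B: "\<And>n. norm (s n) \<le> B"
        using convergent_imp_bounded[OF lim] unfolding bounded_iff by blast
      have "cmod (c n) \<le> B / d" for n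
      proof -
        have "d * cmod (c n) \<le> B" using lb[OF yc(1)[of n], of "c n"] yc(2)[of n] B[of n] by simp
        then show ?thesis using d by (simp add: field_simps)
      qed
      then show ?thesis unfolding bounded_iff by blast
    qed
    then obtain c0 r where r: "strict_mono r" "(c \<circ> r) \<longlonglongrightarrow> c0"
      using bounded_imp_convergent_subsequence by blast
    have "(\<lambda>n. cscale (c (r n)) v) \<longlonglongrightarrow> cscale c0 v"
      using bounded_linear.tendsto[OF bounded_linear_cscale_left r(2)] by (simp add: o_def)
    moreover have "(\<lambda>n. s (r n)) \<longlonglongrightarrow> l"
      using LIMSEQ_subseq_LIMSEQ[OF lim r(1)] by (simp add: o_def)
    ultimately have "(\<lambda>n. s (r n) - cscale (c (r n)) v) \<longlonglongrightarrow> l - cscale c0 v"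
      by (intro tendsto_diff)
    then have "(\<lambda>n. y (r n)) \<longlonglongrightarrow> l - cscale c0 v" by (simp add: yc(2))
    then have "l - cscale c0 v \<in> Y"
      by (rule Lim_in_closed_set[OF cl, rotated 2]) (simp_all add: yc(1))
    then have "(l - cscale c0 v) + cscale c0 v \<in> Y + range (\<lambda>c. cscale c v)"
      by (rule set_plus_intro[OF _ rangeI])
    then show "l \<in> Y + range (\<lambda>c. cscale c v)" by simp
  qed
qed

lemma closed_subspace_plus_span:
  assumes "finite F" "closed_subspace Y"
  shows "closed_subspace (Y + cvs.span F)"
  using assms
proof (induction F arbitrary: Y rule: finite_induct)
  case empty
  have "Y + {0} = Y" by (simp add: set_plus_def)
  then show ?case using empty by simp
next
  case (insert v F)
  have line: "csubspace (range (\<lambda>c. cscale c v))"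
    unfolding csubspace_iff using cvs.subspace_span[of "{v}"] by (simp add: cvs.span_singleton)
  have "closed_subspace (Y + range (\<lambda>c. cscale c v))"
    using insert.prems closed_plus_line csubspace_plus[OF _ line] by (auto simp: closed_subspace_def)
  then have "closed_subspace ((Y + range (\<lambda>c. cscale c v)) + cvs.span F)" by (rule insert.IH)
  moreover have "range (\<lambda>c. cscale c v) + cvs.span F = cvs.span (insert v F)"
    using cvs.span_Un[of "{v}" F] by (auto simp: set_plus_def cvs.span_singleton)
  ultimately show ?case by (simp add: add.assoc)
qed

lemma closed_subspace_plus_fin_dim:
  assumes "closed_subspace Y" "csubspace W" "fin_dim W"
  shows "closed_subspace (Y + W)"
  using assms closed_subspace_plus_span fin_dim_basis by metis

lemma closed_subspace_fin_dim:
  assumes "csubspace W" "fin_dim W"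
  shows "closed_subspace W"
proof -
  have "closed_subspace {0}" by (simp add: closed_subspace_def csubspace_def)
  then have "closed_subspace ({0} + W)" by (rule closed_subspace_plus_fin_dim[OF _ assms])
  then show ?thesis by (simp add: set_plus_def)
qed

text \<open>A real functional dominated by the distance to Y is nonpositive at y and at -y, so it
  vanishes on Y; its complexification does too, as Y is closed under multiplication by i.\<close>

lemma hahn_banach_separating:
  fixes v :: "'a::complex_banach"
  assumes Y: "closed_subspace Y" and v: "v \<notin> Y"
  obtains \<phi> :: "'a \<Rightarrow> complex" where "bounded_linear \<phi>" "\<And>c x. \<phi> (cscale c x) = c * \<phi> x"
    "\<And>y. y \<in> Y \<Longrightarrow> \<phi> y = 0" "\<phi> v = 1"
proof -
  have sub: "subspace Y" and cl: "closed Y" and cs: "csubspace Y"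
    using closed_subspace_imp_subspace[OF Y] Y by (auto simp only: closed_subspace_def)
  obtain g where g: "linear g" "g \<le> (\<lambda>x. infdist x Y)" "g v = infdist v Y"
    using hahn_banach_sublinear[OF sublinear_infdist[OF sub]] by blast
  have gY: "g y = 0" if "y \<in> Y" for y
  proof -
    have "- y \<in> Y" using sub that subspace_neg by blast
    then have "g y \<le> 0" "g (- y) \<le> 0"
      using g(2) that by (auto simp: le_fun_def) (metis infdist_zero)+
    then show ?thesis using linear_neg[OF g(1), of y] by simp
  qed
  have gn: "\<bar>g x\<bar> \<le> norm x" for x
  proof -
    have "g z \<le> norm z" for z
    proof -
      have "g z \<le> infdist z Y" using g(2) by (simp add: le_fun_def)
      also have "\<dots> \<le> norm z" using infdist_le[OF subspace_0[OF sub], of z] by simp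
      finally show ?thesis .
    qed
    from this[of x] this[of "- x"] show ?thesis using linear_neg[OF g(1), of x] by simp
  qed
  \<comment> \<open>g(x) - i g(ix) is the unique complex-linear functional with real part g.\<close>
  define h where "h x = Complex (g x) (- g (cscale \<i> x))" for x
  have hadd: "h (x + y) = h x + h y" for x y
    by (simp add: h_def linear_add[OF g(1)] cscale_add_right complex_eq_iff)
  have hR: "h (r *\<^sub>R x) = of_real r * h x" for r x
    by (simp add: h_def linear_scale[OF g(1)] cscale_scaleR complex_eq_iff)
  have hi: "h (cscale \<i> x) = \<i> * h x" for x
  proof -
    have "cscale \<i> (cscale \<i> x) = - x"
      by (simp add: cscale_cscale cvs.scale_minus_left cscale_one)
    then show ?thesis by (simp add: h_def linear_neg[OF g(1)] complex_eq_iff)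
  qed
  have hC: "h (cscale c x) = c * h x" for c x
  proof -
    have "cscale c x = Re c *\<^sub>R x + Im c *\<^sub>R cscale \<i> x"
      by (metis complex_eq cscale_add_left cscale_cscale cscale_of_real mult.commute)
    then have "h (cscale c x) = (of_real (Re c) + of_real (Im c) * \<i>) * h x"
      by (simp add: hadd hR hi algebra_simps)
    then show ?thesis by (metis complex_eq mult.commute)
  qed
  have bl: "bounded_linear h"
  proof (rule bounded_linear_intro[where K = 2])
    show "norm (h x) \<le> norm x * 2" for x
    proof -
      have "norm (h x) \<le> \<bar>g x\<bar> + \<bar>- g (cscale \<i> x)\<bar>" using cmod_le[of "h x"] by (simp add: h_def)
      also have "\<dots> \<le> norm x * 2" using gn[of x] gn[of "cscale \<i> x"] by (simp add: norm_cscale)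
      finally show ?thesis .
    qed
  qed (simp_all add: hadd hR scaleR_conv_of_real)
  have "infdist v Y > 0" using infdist_pos_not_in_closed[OF cl _ v] subspace_0[OF sub] by blast
  then have hv: "h v \<noteq> 0" using g(3) by (simp add: h_def complex_eq_iff)
  show thesis
  proof (rule that[of "\<lambda>x. h x / h v"])
    show "bounded_linear (\<lambda>x. h x / h v)"
      using bounded_linear_compose[OF bounded_linear_divide bl] by (simp add: o_def)
    show "h y / h v = 0" if "y \<in> Y" for y
    proof -
      have "g (cscale \<i> y) = 0" using gY cs that by (simp add: csubspace_def)
      then have "h y = 0" using gY[OF that] by (simp add: h_def complex_eq_iff)
      then show ?thesis by simp
    qed
  qed (use hv hC in auto)
qed

section \<open>Closed direct sums\<close>

lemma image_add_Times: "(\<lambda>p. fst p + snd p) ` (A \<times> B) = A + B"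
proof (intro equalityI subsetI)
  fix x assume "x \<in> A + B"
  then obtain a b where "x = a + b" "a \<in> A" "b \<in> B" by (rule set_plus_elim)
  then show "x \<in> (\<lambda>p. fst p + snd p) ` (A \<times> B)" by (intro image_eqI[of _ _ "(a, b)"]) auto
next
  fix x assume "x \<in> (\<lambda>p. fst p + snd p) ` (A \<times> B)"
  then obtain a b where "x = a + b" "a \<in> A" "b \<in> B" by auto
  then show "x \<in> A + B" by (simp only: set_plus_intro)
qed

text \<open>Addition is a bounded bijection of the product onto the closed sum; the open mapping
  theorem bounds its inverse, that is, both component projections.\<close>

lemma direct_sum_bound:
  fixes A B :: "'b::banach set"
  assumes "subspace A" "closed A" "subspace B" "closed B" "A \<inter> B = {0}" "closed (A + B)"
  obtains C where "C > 0" "\<And>a b. a \<in> A \<Longrightarrow> b \<in> B \<Longrightarrow> norm (a, b) \<le> C * norm (a + b)"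
proof -
  let ?f = "\<lambda>p::'b \<times> 'b. fst p + snd p"
  have img: "?f ` (A \<times> B) = A + B" by (rule image_add_Times)
  have bl: "bounded_linear ?f" by (intro bounded_linear_add bounded_linear_fst bounded_linear_snd)
  have "closed (?f ` (A \<times> B))" using assms(6) by (simp only: img)
  then obtain C where C: "C > 0"
    "\<And>y. y \<in> A + B \<Longrightarrow> \<exists>x\<in>A \<times> B. ?f x = y \<and> norm x \<le> C * norm y"
    using open_mapping_on[OF bl subspace_Times[OF assms(1,3)] closed_Times[OF assms(2,4)]]
    unfolding img by blast
  have "norm (a, b) \<le> C * norm (a + b)" if ab0: "a \<in> A" "b \<in> B" for a b
  proof -
    obtain a' b' where ab: "a' \<in> A" "b' \<in> B" "a' + b' = a + b" "norm (a', b') \<le> C * norm (a + b)"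
      using C(2)[OF set_plus_intro[OF ab0]] by auto
    have "a' - a = b - b'" using ab(3) by (simp add: algebra_simps)
    moreover have "a' - a \<in> A" using ab0 ab assms(1) by (simp add: subspace_diff)
    moreover have "b - b' \<in> B" using ab0 ab assms(3) by (simp add: subspace_diff)
    ultimately have "a' - a \<in> A \<inter> B" by simp
    then have "a' = a" unfolding assms(5) by simp
    moreover have "b' = b" using ab(3) calculation by simp
    ultimately show ?thesis using ab(4) by simp
  qed
  with C(1) show thesis by (rule that)
qed

text \<open>A sum of two closed subspaces can fail to be closed. Here addition is bounded below on
  the product, so it maps complete subspaces to complete ones.\<close>

lemma closed_plus_of_direct:
  fixes A B :: "'b::banach set"
  assumes "subspace A" "closed A" "subspace B" "closed B" "A \<inter> B = {0}" "closed (A + B)"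
    and A': "A' \<subseteq> A" "subspace A'" "closed A'" and B': "B' \<subseteq> B" "subspace B'" "closed B'"
  shows "closed (A' + B')"
proof -
  obtain C where C: "C > 0" "\<And>a b. a \<in> A \<Longrightarrow> b \<in> B \<Longrightarrow> norm (a, b) \<le> C * norm (a + b)"
    using direct_sum_bound[OF assms(1-6)] by blast
  let ?f = "\<lambda>p::'b \<times> 'b. fst p + snd p"
  have img: "?f ` (A' \<times> B') = A' + B'" by (rule image_add_Times)
  have "complete (?f ` (A' \<times> B'))"
  proof (rule complete_isometric_image)
    show "0 < 1 / C" using C by simp
    show "subspace (A' \<times> B')" using A' B' by (simp add: subspace_Times)
    show "bounded_linear ?f" by (intro bounded_linear_add bounded_linear_fst bounded_linear_snd)
    show "\<forall>x\<in>A' \<times> B'. 1 / C * norm x \<le> norm (fst x + snd x)"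
    proof
      fix x assume "x \<in> A' \<times> B'"
      then obtain a b where "x = (a, b)" "a \<in> A" "b \<in> B" using A'(1) B'(1) by blast
      then show "1 / C * norm x \<le> norm (fst x + snd x)" using C(2)[of a b] C(1) by (simp add: field_simps)
    qed
    show "complete (A' \<times> B')" using A' B' by (simp add: complete_eq_closed closed_Times)
  qed
  then show ?thesis unfolding img by (simp only: complete_eq_closed)
qed

section \<open>Hyperrange and isolated eigenvalues\<close>

text \<open>The preimage of the image of Y in M is Y + N(S), which is closed because N(S) is
  finite-dimensional. Closed range turns nearness of images into nearness modulo N(S), so a limit of
  images comes from this preimage.\<close>

lemma closed_subspace_image_upper_semi_fredholm:
  fixes S :: "'a::complex_banach \<Rightarrow> 'a"
  assumes S: "bounded_op S" and M: "closed_subspace M" and F: "upper_semi_fredholm_on M S"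
    and Y: "closed_subspace Y" "Y \<subseteq> M"
  shows "closed_subspace (S ` Y)"
proof -
  have csM: "cvs.subspace M" and clM: "closed M"
    using M by (auto simp: closed_subspace_def csubspace_iff)
  have clR: "closed (S ` M)" using F by (simp add: upper_semi_fredholm_on_def)
  obtain C where C: "C > 0" "\<And>y. y \<in> S ` M \<Longrightarrow> \<exists>x\<in>M. S x = y \<and> norm x \<le> C * norm y"
    using open_mapping_on[OF bounded_op_imp_bounded_linear[OF S] closed_subspace_imp_subspace[OF M] clM clR]
    by blast
  have csK: "csubspace (kernel_on M S)"
    using csubspace_kernel_on[OF S] csM by (simp add: csubspace_iff)
  have "closed_subspace (Y + kernel_on M S)"
    using closed_subspace_plus_fin_dim[OF Y(1) csK] F by (simp add: upper_semi_fredholm_on_def)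
  then have clYK: "closed (Y + kernel_on M S)" by (simp add: closed_subspace_def)
  have "z \<in> S ` Y" if z: "z \<in> closure (S ` Y)" for z
  proof -
    have "z \<in> S ` M" using z closure_minimal[of "S ` Y" "S ` M"] Y(2) clR by blast
    then obtain x where x: "x \<in> M" "z = S x" by blast
    have "x \<in> closure (Y + kernel_on M S)"
      unfolding closure_approachable
    proof (intro allI impI)
      fix e :: real assume e: "e > 0"
      then obtain y where y: "y \<in> Y" "dist (S y) z < e / C"
        using z divide_pos_pos[OF e C(1)] unfolding closure_approachable by blast
      have xy: "x - y \<in> M" using x y Y(2) csM cvs.subspace_diff by blast
      \<comment> \<open>\<open>w\<close> has the same image as \<open>x - y\<close> but norm below
        \<open>e\<close>. Their difference is in the kernel, and adding it to \<open>y\<close>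
        approximates \<open>x\<close>.\<close>
      then obtain w where w: "w \<in> M" "S w = S (x - y)" "norm w \<le> C * norm (S (x - y))"
        using C(2) by blast
      have "norm (S (x - y)) < e / C"
        using y(2) by (simp add: bounded_op_diff[OF S] x(2) dist_norm norm_minus_commute)
      then have "C * norm (S (x - y)) < e" using C(1) by (simp add: field_simps)
      then have "norm w < e" using w(3) by simp
      moreover have "x - y - w \<in> kernel_on M S"
        using w xy csM cvs.subspace_diff by (auto simp: kernel_on_def bounded_op_diff[OF S])
      then have "y + (x - y - w) \<in> Y + kernel_on M S" using y(1) by (rule set_plus_intro[rotated])
      ultimately show "\<exists>u\<in>Y + kernel_on M S. dist u x < e"
        by (intro bexI[of _ "y + (x - y - w)"]) (auto simp: dist_norm)
    qed
    then have "x \<in> Y + kernel_on M S" using clYK by simp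
    then obtain y k where "x = y + k" "y \<in> Y" "k \<in> kernel_on M S" by (rule set_plus_elim)
    then show ?thesis using x(2) by (simp add: bounded_op_add[OF S] kernel_on_def)
  qed
  then have "closed (S ` Y)" using closure_subset_eq by blast
  then show ?thesis using csubspace_image[OF S] Y(1) by (simp add: closed_subspace_def)
qed

lemma closed_subspace_image_funpow:
  assumes S: "bounded_op S" and M: "closed_subspace M" "S ` M \<subseteq> M" and F: "upper_semi_fredholm_on M S"
  shows "closed_subspace ((S ^^ n) ` M)"
proof (induction n)
  case (Suc n)
  have "closed_subspace (S ` ((S ^^ n) ` M))"
    by (rule closed_subspace_image_upper_semi_fredholm[OF S M(1) F Suc funpow_invariant[OF M(2)]])
  then show ?case by (simp add: image_comp)
qed (simp add: M)

definition hyperrange :: "'a set \<Rightarrow> ('a \<Rightarrow> 'a) \<Rightarrow> 'a set" where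
  "hyperrange M S = (\<Inter>n. (S ^^ n) ` M)"

lemma hyperrange_subset: "hyperrange M S \<subseteq> M"
  unfolding hyperrange_def by (rule INF_lower2[of 0]) auto

lemma funpow_image_decseq:
  assumes "S ` M \<subseteq> M"
  shows "decseq (\<lambda>n. (S ^^ n) ` M)"
proof (rule decseq_SucI)
  fix n
  have "(S ^^ Suc n) ` M = (S ^^ n) ` (S ` M)" by (simp add: image_comp funpow_Suc_right del: funpow.simps)
  then show "(S ^^ Suc n) ` M \<subseteq> (S ^^ n) ` M" using assms by (simp only: image_mono)
qed

lemma csubspace_image_funpow:
  assumes "bounded_op S" "csubspace M"
  shows "csubspace ((S ^^ n) ` M)"
  using assms by (intro csubspace_image bounded_op_funpow)

lemma csubspace_hyperrange:
  assumes "bounded_op S" "csubspace M"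
  shows "csubspace (hyperrange M S)"
  using csubspace_image_funpow[OF assms] unfolding hyperrange_def csubspace_iff
  by (intro cvs.subspace_Int)

lemma closed_subspace_hyperrange:
  assumes "bounded_op S" "closed_subspace M" "S ` M \<subseteq> M" "upper_semi_fredholm_on M S"
  shows "closed_subspace (hyperrange M S)"
proof -
  have "csubspace (hyperrange M S)"
    using csubspace_hyperrange[OF assms(1)] assms(2) by (simp add: closed_subspace_def)
  moreover have "closed (hyperrange M S)"
    unfolding hyperrange_def
    by (rule closed_INT) (use closed_subspace_image_funpow[OF assms] in \<open>simp add: closed_subspace_def\<close>)
  ultimately show ?thesis by (simp add: closed_subspace_def)
qed

text \<open>If S x = S^(n+1) m, then x differs from S^n m by a kernel vector, which lies in every
  range. So every preimage of a hyperrange vector qualifies, and preimages can be chosen by their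
  norm alone.\<close>

lemma hyperrange_preimage:
  assumes S: "bounded_op S" and M: "csubspace M" "S ` M \<subseteq> M"
    and K: "kernel_on M S \<subseteq> hyperrange M S" and x: "x \<in> M" "S x \<in> hyperrange M S"
  shows "x \<in> hyperrange M S"
  unfolding hyperrange_def
proof
  fix n
  have "S x \<in> (S ^^ Suc n) ` M" using x(2) unfolding hyperrange_def by blast
  then obtain m where m: "m \<in> M" "S x = S ((S ^^ n) m)" by auto
  have "(S ^^ n) m \<in> M" using funpow_invariant[OF M(2)] m(1) by blast
  then have "x - (S ^^ n) m \<in> kernel_on M S"
    using M x m cvs.subspace_diff by (auto simp: kernel_on_def bounded_op_diff[OF S] csubspace_iff)
  then have "x - (S ^^ n) m \<in> (S ^^ n) ` M" using K unfolding hyperrange_def by blast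
  moreover have "cvs.subspace ((S ^^ n) ` M)"
    using csubspace_image_funpow[OF S M(1)] by (simp add: csubspace_iff)
  ultimately have "x - (S ^^ n) m + (S ^^ n) m \<in> (S ^^ n) ` M"
    using m(1) cvs.subspace_add by blast
  then show "x \<in> (S ^^ n) ` M" by simp
qed

text \<open>The subspaces N(S) \<inter> R(S^n) decrease within a finite-dimensional space, so the
  infinite intersection is reached at a finite stage.\<close>

lemma kernel_range_chain_stabilizes:
  assumes S: "bounded_op S" and M: "csubspace M" "S ` M \<subseteq> M" and fin: "fin_dim (kernel_on M S)"
  obtains n where "kernel_on M S \<inter> (S ^^ n) ` M = kernel_on M S \<inter> hyperrange M S"
proof -
  let ?K = "\<lambda>n. kernel_on M S \<inter> (S ^^ n) ` M"
  have dec: "decseq ?K"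
    using funpow_image_decseq[OF M(2)] unfolding decseq_def by (meson Int_mono order_refl)
  obtain n where n: "\<And>m. m \<ge> n \<Longrightarrow> ?K m = ?K n"
  proof (rule fin_dim_chain_stabilizes[OF _ dec, of 0])
    show "csubspace (?K n)" for n
      by (intro csubspace_Int csubspace_kernel_on csubspace_image_funpow S M)
    show "fin_dim (?K 0)" using fin by (rule fin_dim_subset) auto
  qed blast
  have "?K n \<subseteq> ?K m" for m
    using n[of m] decseqD[OF dec, of m n] by (cases "m \<ge> n") auto
  then have "?K n = kernel_on M S \<inter> hyperrange M S" unfolding hyperrange_def by blast
  then show thesis by (rule that)
qed

text \<open>Kernel vectors may lie outside the hyperrange, so a preimage must be taken deep enough.
  Past the stage of stabilization, two preimages of z in R(S^n) differ by a vector of N(S) \<inter>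
  R(S^n), which is in all ranges; hence a preimage in R(S^n) already lies in every R(S^k).\<close>

lemma hyperrange_image:
  assumes S: "bounded_op S" and M: "csubspace M" "S ` M \<subseteq> M" and fin: "fin_dim (kernel_on M S)"
  shows "S ` hyperrange M S = hyperrange M S"
proof
  have "S x \<in> (S ^^ n) ` M" if x: "x \<in> hyperrange M S" for x n
  proof -
    obtain m where "m \<in> M" "x = (S ^^ n) m" using x unfolding hyperrange_def by blast
    then show ?thesis using M(2) by (intro image_eqI[of _ _ "S m"]) (auto simp: funpow_swap1)
  qed
  then show "S ` hyperrange M S \<subseteq> hyperrange M S" unfolding hyperrange_def by blast
next
  obtain n where n: "kernel_on M S \<inter> (S ^^ n) ` M = kernel_on M S \<inter> hyperrange M S"
    using kernel_range_chain_stabilizes[OF assms] by blast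
  show "hyperrange M S \<subseteq> S ` hyperrange M S"
  proof
    fix z assume z: "z \<in> hyperrange M S"
    have pre: "\<exists>x\<in>(S ^^ k) ` M. S x = z" for k
    proof -
      have "z \<in> (S ^^ Suc k) ` M" using z unfolding hyperrange_def by blast
      then show ?thesis by auto
    qed
    then obtain x where x: "x \<in> (S ^^ n) ` M" "S x = z" by blast
    have "x \<in> (S ^^ k) ` M" for k
    proof (cases "k \<le> n")
      case True
      then show ?thesis using x decseqD[OF funpow_image_decseq[OF M(2)] True] by blast
    next
      case False
      obtain y where y: "y \<in> (S ^^ k) ` M" "S y = z" using pre by blast
      have yn: "y \<in> (S ^^ n) ` M" using y decseqD[OF funpow_image_decseq[OF M(2)], of n k] False by force
      have sub: "cvs.subspace ((S ^^ j) ` M)" for j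
        using csubspace_image_funpow[OF S M(1)] by (simp add: csubspace_iff)
      have "x - y \<in> (S ^^ n) ` M" using x(1) yn sub cvs.subspace_diff by blast
      moreover have "x - y \<in> kernel_on M S"
        using calculation funpow_invariant[OF M(2)] x(2) y(2)
        by (auto simp: kernel_on_def bounded_op_diff[OF S])
      ultimately have "x - y \<in> (S ^^ k) ` M" using n unfolding hyperrange_def by blast
      then have "x - y + y \<in> (S ^^ k) ` M" using y(1) sub cvs.subspace_add by blast
      then show ?thesis by simp
    qed
    then show "z \<in> S ` hyperrange M S" using x(2) unfolding hyperrange_def by blast
  qed
qed

text \<open>Stabilization gives N(S) \<inter> R(S^n) = {0} for some n, and then S^(n+1) x = 0 forces
  S^n x = 0. With the converse \<open>kernel_hyperrange_trivial\<close>, ascent can be treated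
  through the hyperrange alone.\<close>

lemma finite_ascent_onI:
  assumes S: "bounded_op S" and M: "csubspace M" "S ` M \<subseteq> M" and fin: "fin_dim (kernel_on M S)"
    and triv: "kernel_on M S \<inter> hyperrange M S = {0}"
  shows "finite_ascent_on M S"
proof -
  obtain n where n: "kernel_on M S \<inter> (S ^^ n) ` M = {0}"
    using kernel_range_chain_stabilizes[OF S M fin] triv by auto
  have "kernel_on M (S ^^ Suc n) \<subseteq> kernel_on M (S ^^ n)"
  proof
    fix x assume x: "x \<in> kernel_on M (S ^^ Suc n)"
    then have "(S ^^ n) x \<in> kernel_on M S \<inter> (S ^^ n) ` M"
      using funpow_invariant[OF M(2)] by (auto simp: kernel_on_def)
    then have "(S ^^ n) x = 0" unfolding n by simp
    then show "x \<in> kernel_on M (S ^^ n)" using x by (simp add: kernel_on_def)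
  qed
  moreover have "kernel_on M (S ^^ n) \<subseteq> kernel_on M (S ^^ Suc n)"
    by (auto simp: kernel_on_def bounded_op_zero[OF S])
  ultimately show ?thesis unfolding finite_ascent_on_def by blast
qed

lemma finite_ascent_on_imp:
  assumes S: "bounded_op S" and M: "csubspace M" and asc: "finite_ascent_on M S"
  obtains p where "kernel_on M S \<inter> (S ^^ p) ` M = {0}"
proof -
  obtain p where p: "kernel_on M (S ^^ p) = kernel_on M (S ^^ Suc p)"
    using asc by (auto simp: finite_ascent_on_def)
  have "x = 0" if x: "x \<in> kernel_on M S" "x \<in> (S ^^ p) ` M" for x
  proof -
    obtain y where y: "y \<in> M" "x = (S ^^ p) y" using x(2) by blast
    then have "y \<in> kernel_on M (S ^^ Suc p)" using x(1) by (simp add: kernel_on_def)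
    then show ?thesis using p y(2) by (auto simp: kernel_on_def)
  qed
  moreover have "0 \<in> kernel_on M S \<inter> (S ^^ p) ` M"
    using csubspace_kernel_on[OF S M] csubspace_image_funpow[OF S M] by (simp add: csubspace_def)
  ultimately show thesis by (intro that[of p]) auto
qed

lemma kernel_hyperrange_trivial:
  assumes S: "bounded_op S" and M: "csubspace M" and asc: "finite_ascent_on M S"
  shows "kernel_on M S \<inter> hyperrange M S = {0}"
proof -
  obtain p where p: "kernel_on M S \<inter> (S ^^ p) ` M = {0}"
    using finite_ascent_on_imp[OF assms] by blast
  have "0 \<in> kernel_on M S \<inter> hyperrange M S"
    using csubspace_kernel_on[OF S M] csubspace_hyperrange[OF S M] by (simp add: csubspace_def)
  then show ?thesis using p unfolding hyperrange_def by blast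
qed

section \<open>Analytic families of eigenvectors\<close>

text \<open>In the sum of z^n X(n), applying S lowers the index of each coefficient and kills the
  first, which amounts to multiplication by z.\<close>

lemma eigenvector_family:
  fixes S :: "'a::complex_banach \<Rightarrow> 'a" and X :: "nat \<Rightarrow> 'a"
  assumes S: "bounded_op S" and M: "closed_subspace M"
    and X: "\<And>n. X n \<in> M" "S (X 0) = 0" "\<And>n. S (X (Suc n)) = X n"
    and C: "C > 0" "\<And>n. norm (X n) \<le> C ^ n * K"
  obtains r f where "r > 0" "c_analytic_on f (ball 0 r)" "f 0 = X 0"
    "\<And>z. z \<in> ball 0 r \<Longrightarrow> f z \<in> M" "\<And>z. z \<in> ball 0 r \<Longrightarrow> shift_op S z (f z) = 0"
proof -
  \<comment> \<open>Half of 1/C: the terms are at most K / 2^n in norm, and the derived series has a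
    summable majorant uniform on the disc, as termwise differentiation requires.\<close>
  define r where "r = 1 / (2 * C)"
  have r: "r > 0" using C(1) by (simp add: r_def)
  have rC: "(r ^ n) * C ^ n = (1/2) ^ n" for n
    using C(1) by (simp add: r_def flip: power_mult_distrib)
  have sums: "(\<lambda>n. cscale (z ^ n) (X n)) sums (\<Sum>n. cscale (z ^ n) (X n))" if z: "z \<in> ball 0 r" for z
  proof (rule summable_sums[OF summable_comparison_test'[of "\<lambda>n. K * (1/2::real) ^ n" 0]])
    show "summable (\<lambda>n. K * (1/2::real) ^ n)" by (intro summable_mult summable_geometric) simp
    fix n :: nat
    have "norm (cscale (z ^ n) (X n)) = cmod z ^ n * norm (X n)" by (simp add: norm_cscale norm_power)
    also have "\<dots> \<le> r ^ n * (C ^ n * K)"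
      using z C(2) r by (intro mult_mono power_mono) auto
    also have "\<dots> = K * (1/2) ^ n" using rC[of n] by (simp add: algebra_simps)
    finally show "norm (cscale (z ^ n) (X n)) \<le> K * (1/2) ^ n" .
  qed
  \<comment> \<open>The terms of the derived series. At n = 0 the truncated exponent is harmless
    because the factor n is 0.\<close>
  define D where "D z n = cscale (of_nat n * z ^ (n - 1)) (X n)" for z n
  define G where "G z = (\<Sum>n. D z n)" for z
  have Dbound: "norm (D z n) \<le> (C * K) * (real n * (1/2) ^ (n - 1))" if z: "z \<in> ball 0 r" for z n
  proof (cases n)
    case (Suc m)
    have "norm (D z n) = real n * cmod z ^ m * norm (X n)"
      by (simp add: D_def norm_cscale norm_mult norm_power Suc del: of_nat_Suc)
    also have "\<dots> \<le> real n * r ^ m * (C ^ n * K)"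
      using z C(2) r by (intro mult_mono power_mono mult_nonneg_nonneg) auto
    also have "\<dots> = (C * K) * (real n * (1/2) ^ (n - 1))"
      using rC[of m] by (simp add: Suc algebra_simps del: of_nat_Suc)
    finally show ?thesis .
  qed (simp add: D_def)
  have "(\<lambda>n. real (Suc n) * (1/2) ^ n) sums (1 / (1 - 1/2)\<^sup>2)"
    by (rule geometric_deriv_sums) simp
  then have "summable (\<lambda>n. real n * (1/2) ^ (n - 1))"
    using sums_summable summable_Suc_iff[of "\<lambda>n. real n * (1/2) ^ (n - 1)"] by fastforce
  then have "summable (\<lambda>n. (C * K) * (real n * (1/2) ^ (n - 1)))" by (rule summable_mult)
  then have unif: "uniform_limit (ball 0 r) (\<lambda>n z. \<Sum>i<n. D z i) G sequentially"
    unfolding G_def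
    using Weierstrass_m_test[of "ball 0 r" "\<lambda>n z. D z n" "\<lambda>n. (C * K) * (real n * (1/2) ^ (n - 1))"] Dbound
    by blast
  have "\<exists>g. \<forall>z\<in>ball 0 r. (\<lambda>n. cscale (z ^ n) (X n)) sums g z \<and>
      (g has_derivative (\<lambda>h. cscale h (G z))) (at z within ball 0 r)"
  proof (rule has_derivative_series[where f' = "\<lambda>n z h. cscale h (D z n)" and x = 0])
    show "convex (ball (0::complex) r)" by simp
    show "(0::complex) \<in> ball 0 r" using r by simp
    show "(\<lambda>n. cscale (0 ^ n) (X n)) sums (\<Sum>n. cscale (0 ^ n) (X n))" using sums r by simp
    show "((\<lambda>z. cscale (z ^ n) (X n)) has_derivative (\<lambda>h. cscale h (D z n))) (at z within ball 0 r)"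
      for n z
    proof -
      have "((\<lambda>z. z ^ n) has_derivative (\<lambda>h. of_nat n * z ^ (n - 1) * h)) (at z within ball 0 r)"
        by (rule has_field_derivative_imp_has_derivative) (auto intro!: derivative_eq_intros)
      from bounded_linear.has_derivative[OF bounded_linear_cscale_left[of "X n"] this]
      show ?thesis by (simp add: D_def cscale_cscale mult.commute)
    qed
    fix e :: real assume e: "e > 0"
    have "\<forall>\<^sub>F n in sequentially. \<forall>z\<in>ball 0 r. dist (\<Sum>i<n. D z i) (G z) < e"
      using uniform_limitD[OF unif e] .
    then show "\<forall>\<^sub>F n in sequentially. \<forall>z\<in>ball 0 r. \<forall>h. norm ((\<Sum>i<n. cscale h (D z i)) - cscale h (G z)) \<le> e * norm h"
    proof (rule eventually_mono, intro ballI allI)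
      fix n z h assume "\<forall>z\<in>ball 0 r. dist (\<Sum>i<n. D z i) (G z) < e" and z: "z \<in> ball (0::complex) r"
      then have "norm ((\<Sum>i<n. D z i) - G z) \<le> e" by (auto simp: dist_norm less_imp_le)
      moreover have "(\<Sum>i<n. cscale h (D z i)) - cscale h (G z) = cscale h ((\<Sum>i<n. D z i) - G z)"
        by (simp add: cvs.scale_right_diff_distrib cvs.scale_sum_right)
      ultimately show "norm ((\<Sum>i<n. cscale h (D z i)) - cscale h (G z)) \<le> e * norm h"
        using mult_left_mono[OF _ norm_ge_zero[of h]] by (simp add: norm_cscale mult.commute[of e])
    qed
  qed
  then obtain f where f: "\<And>z. z \<in> ball 0 r \<Longrightarrow> (\<lambda>n. cscale (z ^ n) (X n)) sums f z"
    "\<And>z. z \<in> ball 0 r \<Longrightarrow> (f has_derivative (\<lambda>h. cscale h (G z))) (at z within ball 0 r)" by blast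
  show thesis
  proof (rule that[OF r])
    show "c_analytic_on f (ball 0 r)"
      unfolding c_analytic_on_def using f(2) at_within_open[of _ "ball (0::complex) r"] by fastforce
    have "(\<lambda>n. cscale (0 ^ n) (X n)) sums X 0"
      using sums_finite[of "{0}" "\<lambda>n. cscale (0 ^ n) (X n)"] by (simp add: cscale_one)
    then show "f 0 = X 0" using f(1)[of 0] r sums_unique2 by simp
  next
    fix z :: complex assume z: "z \<in> ball 0 r"
    show "f z \<in> M"
    proof (rule Lim_in_closed_set)
      show "closed M" using M by (simp add: closed_subspace_def)
      show "(\<lambda>n. \<Sum>i<n. cscale (z ^ i) (X i)) \<longlonglongrightarrow> f z" using f(1)[OF z] by (simp add: sums_def)
      have "cvs.subspace M" using M by (simp add: closed_subspace_def csubspace_iff)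
      then show "\<forall>\<^sub>F n in sequentially. (\<Sum>i<n. cscale (z ^ i) (X i)) \<in> M"
        using X(1) by (intro always_eventually allI cvs.subspace_sum cvs.subspace_scale)
    qed simp
    have "(\<lambda>n. S (cscale (z ^ n) (X n))) sums S (f z)"
      using bounded_linear.sums[OF bounded_op_imp_bounded_linear[OF S] f(1)[OF z]] .
    \<comment> \<open>The index shift loses only the term of index 0, which vanishes because
      \<open>S (X 0) = 0\<close>.\<close>
    then have "(\<lambda>n. S (cscale (z ^ Suc n) (X (Suc n)))) sums (S (f z) - S (cscale (z ^ 0) (X 0)))"
      by (subst sums_Suc_iff) simp
    then have "(\<lambda>n. cscale z (cscale (z ^ n) (X n))) sums S (f z)"
      by (simp add: bounded_op_cscale[OF S] X cscale_cscale)
    moreover have "(\<lambda>n. cscale z (cscale (z ^ n) (X n))) sums cscale z (f z)"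
      using bounded_linear.sums[OF bounded_linear_cscale f(1)[OF z]] .
    ultimately show "shift_op S z (f z) = 0" using sums_unique2 by (simp add: shift_op_def)
  qed
qed

text \<open>Iterating a norm-controlled choice of preimages within \<open>Z\<close> gives the
  coefficients. \<open>Z\<close> stands for a hyperrange and is not assumed closed, so the sums are
  placed in \<open>M\<close>. As f(0) = x0, continuity keeps f away from 0 on a smaller
  disc.\<close>

lemma eigenvector_family_of_backward_orbit:
  fixes S :: "'a::complex_banach \<Rightarrow> 'a"
  assumes S: "bounded_op S" and M: "closed_subspace M"
    and Z: "Z \<subseteq> M" "C > 0" "\<And>z. z \<in> Z \<Longrightarrow> \<exists>x\<in>Z. S x = z \<and> norm x \<le> C * norm z"
    and x0: "x0 \<in> Z" "S x0 = 0" "x0 \<noteq> 0"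
  obtains r f where "r > 0" "c_analytic_on f (ball 0 r)"
    "\<forall>z\<in>ball 0 r. f z \<in> M \<and> f z \<noteq> 0 \<and> shift_op S z (f z) = 0"
proof -
  obtain g where g: "\<And>z. z \<in> Z \<Longrightarrow> g z \<in> Z" "\<And>z. z \<in> Z \<Longrightarrow> S (g z) = z"
    "\<And>z. z \<in> Z \<Longrightarrow> norm (g z) \<le> C * norm z" using Z(3) by metis
  define X where "X n = (g ^^ n) x0" for n
  have XZ: "X n \<in> Z" for n by (induction n) (simp_all add: X_def x0 g)
  have Xn: "norm (X n) \<le> C ^ n * norm x0" for n
  proof (induction n)
    case (Suc n)
    have "norm (X (Suc n)) \<le> C * norm (X n)" using g(3)[OF XZ] by (simp add: X_def)
    also have "\<dots> \<le> C * (C ^ n * norm x0)" using Suc Z(2) by (intro mult_left_mono) auto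
    finally show ?case by simp
  qed (simp add: X_def)
  obtain r f where f: "r > 0" "c_analytic_on f (ball 0 r)" "f 0 = X 0"
    "\<And>z. z \<in> ball 0 r \<Longrightarrow> f z \<in> M" "\<And>z. z \<in> ball 0 r \<Longrightarrow> shift_op S z (f z) = 0"
  proof (rule eigenvector_family[OF S M _ _ _ Z(2) Xn])
    show "S (X (Suc n)) = X n" for n using g(2)[OF XZ] by (simp add: X_def)
  qed (use XZ Z(1) x0 in \<open>auto simp: X_def\<close>)
  have f0: "f 0 \<noteq> 0" using f(3) x0(3) by (simp add: X_def)
  have "\<exists>v. (f has_derivative (\<lambda>h. cscale h v)) (at 0)" using f(1,2) by (simp add: c_analytic_on_def)
  then have "isCont f 0" using has_derivative_continuous by blast
  then obtain d where d: "d > 0" "\<And>z. dist z 0 < d \<Longrightarrow> f z \<noteq> 0"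
    using continuous_at_avoid[of 0 f 0] f0 by (auto simp: dist_commute)
  show thesis
  proof (rule that[of "min r d" f])
    show "c_analytic_on f (ball 0 (min r d))" using f(2) by (simp add: c_analytic_on_def)
  qed (use f d in auto)
qed

text \<open>The kernel may be infinite-dimensional, so no stabilization is available; the Kato
  inclusion replaces it through \<open>hyperrange_preimage\<close>.\<close>

lemma kato_eigenvector_family:
  fixes S :: "'a::complex_banach \<Rightarrow> 'a"
  assumes S: "bounded_op S" and M: "closed_subspace M" "S ` M \<subseteq> M" and kato: "kato_on M S"
    and ninj: "\<not> inj_on S M"
  obtains r f where "r > 0" "c_analytic_on f (ball 0 r)"
    "\<forall>z\<in>ball 0 r. f z \<in> M \<and> f z \<noteq> 0 \<and> shift_op S z (f z) = 0"
proof -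
  have cs: "csubspace M" and cl: "closed M" using M by (auto simp: closed_subspace_def)
  have clR: "closed (S ` M)" and ker: "kernel_on M S \<subseteq> hyperrange M S"
    using kato by (auto simp: kato_on_def hyperrange_def)
  obtain C where C: "C > 0" "\<And>y. y \<in> S ` M \<Longrightarrow> \<exists>x\<in>M. S x = y \<and> norm x \<le> C * norm y"
    using open_mapping_on[OF bounded_op_imp_bounded_linear[OF S] closed_subspace_imp_subspace[OF M(1)] cl clR]
    by blast
  have "0 \<in> kernel_on M S" using csubspace_kernel_on[OF S cs] by (simp add: csubspace_def)
  then obtain x0 where x0: "x0 \<in> kernel_on M S" "x0 \<noteq> 0"
    using ninj inj_on_iff_kernel_on[OF S cs] by blast
  have pre: "\<exists>x\<in>hyperrange M S. S x = z \<and> norm x \<le> C * norm z" if z: "z \<in> hyperrange M S" for z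
  proof -
    have "z \<in> (S ^^ Suc 0) ` M" using z unfolding hyperrange_def by blast
    then have "z \<in> S ` M" by simp
    then obtain x where "x \<in> M" "S x = z" "norm x \<le> C * norm z" using C(2) by blast
    then show ?thesis using hyperrange_preimage[OF S cs M(2) ker] z by blast
  qed
  have x0': "x0 \<in> hyperrange M S" "S x0 = 0" using x0(1) ker by (auto simp: kernel_on_def)
  show thesis
    by (rule eigenvector_family_of_backward_orbit[OF S M(1) hyperrange_subset C(1) pre x0' x0(2)])
      (assumption | rule that)+
qed

section \<open>Injectivity of S - z near z = 0\<close>

text \<open>Such an x is S^n applied to z^(-n) x. Injectivity of S - z for z \<noteq> 0 can thus be
  tested on the hyperrange.\<close>

lemma eigenvector_in_hyperrange:
  assumes S: "bounded_op S" and M: "csubspace M" and x: "x \<in> M" "S x = cscale z x" "z \<noteq> 0"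
  shows "x \<in> hyperrange M S"
  unfolding hyperrange_def
proof
  fix n
  have "(S ^^ n) x = cscale (z ^ n) x"
    by (induction n) (simp_all add: cscale_one bounded_op_cscale[OF S] x(2) cscale_cscale mult.commute)
  then have "(S ^^ n) (cscale (inverse z ^ n) x) = x"
    using x(3) bounded_op_cscale[OF bounded_op_funpow[OF S]]
    by (simp add: cscale_cscale cscale_one flip: power_mult_distrib)
  moreover have "cscale (inverse z ^ n) x \<in> M" using M x(1) by (simp add: csubspace_def)
  ultimately show "x \<in> (S ^^ n) ` M" by (metis image_eqI)
qed

text \<open>S is injective on its closed hyperrange and maps it onto itself, so the norm of x is at
  most C times that of S x there. An eigenvalue with 0 < |z| < 1/C would contradict this. At z = 0 a
  kernel outside the hyperrange may remain.\<close>

lemma punctured_inj_on: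
  fixes S :: "'a::complex_banach \<Rightarrow> 'a"
  assumes S: "bounded_op S" and M: "closed_subspace M" "S ` M \<subseteq> M" and F: "upper_semi_fredholm_on M S"
    and triv: "kernel_on M S \<inter> hyperrange M S = {0}"
  obtains e where "e > 0" "\<And>z. z \<noteq> 0 \<Longrightarrow> cmod z < e \<Longrightarrow> inj_on (shift_op S z) M"
proof -
  let ?Z = "hyperrange M S"
  have cs: "csubspace M" using M by (simp add: closed_subspace_def)
  have fin: "fin_dim (kernel_on M S)" using F by (simp add: upper_semi_fredholm_on_def)
  have Z: "closed_subspace ?Z" by (rule closed_subspace_hyperrange[OF S M F])
  have SZ: "S ` ?Z = ?Z" by (rule hyperrange_image[OF S cs M(2) fin])
  have clZ: "closed ?Z" using Z by (simp add: closed_subspace_def)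
  have clSZ: "closed (S ` ?Z)" using clZ by (simp only: SZ)
  obtain C where C: "C > 0" "\<And>y. y \<in> S ` ?Z \<Longrightarrow> \<exists>x\<in>?Z. S x = y \<and> norm x \<le> C * norm y"
    using open_mapping_on[OF bounded_op_imp_bounded_linear[OF S] closed_subspace_imp_subspace[OF Z] clZ clSZ]
    by blast
  have "kernel_on ?Z S = kernel_on M S \<inter> ?Z"
    using hyperrange_subset[of M S] by (auto simp: kernel_on_def)
  then have "kernel_on ?Z S = {0}" by (simp only: triv)
  then have injZ: "inj_on S ?Z"
    using inj_on_iff_kernel_on[OF S] Z by (simp add: closed_subspace_def)
  have low: "norm x \<le> C * norm (S x)" if x: "x \<in> ?Z" for x
  proof -
    obtain y where "y \<in> ?Z" "S y = S x" "norm y \<le> C * norm (S x)" using C(2)[of "S x"] x by blast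
    then show ?thesis using injZ x by (metis inj_onD)
  qed
  show thesis
  proof (rule that[of "1 / C"])
    show "1 / C > 0" using C by simp
    fix z assume z: "z \<noteq> 0" "cmod z < 1 / C"
    have "x = 0" if "x \<in> kernel_on M (shift_op S z)" for x
    proof (rule ccontr)
      assume nz: "x \<noteq> 0"
      have x: "x \<in> M" "S x = cscale z x" using that by (auto simp: kernel_on_def shift_op_def)
      have "norm x \<le> C * (cmod z * norm x)"
        using low[OF eigenvector_in_hyperrange[OF S cs x z(1)]] by (simp add: x(2) norm_cscale)
      also have "\<dots> < norm x" using z(2) C(1) nz by (simp add: field_simps)
      finally show False by simp
    qed
    moreover have "0 \<in> kernel_on M (shift_op S z)"
      using csubspace_kernel_on[OF bounded_op_shift[OF S] cs] by (simp add: csubspace_def)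
    ultimately show "inj_on (shift_op S z) M"
      using inj_on_iff_kernel_on[OF bounded_op_shift[OF S] cs] by blast
  qed
qed

text \<open>S maps its closed hyperrange onto itself, so the open mapping theorem supplies
  controlled preimages, and a nonzero kernel vector in the hyperrange starts a backward
  orbit.\<close>

lemma nearby_not_inj_on:
  fixes S :: "'a::complex_banach \<Rightarrow> 'a"
  assumes S: "bounded_op S" and M: "closed_subspace M" "S ` M \<subseteq> M" and F: "upper_semi_fredholm_on M S"
    and ntriv: "kernel_on M S \<inter> hyperrange M S \<noteq> {0}"
  obtains e where "e > 0" "\<And>z. cmod z < e \<Longrightarrow> \<not> inj_on (shift_op S z) M"
proof -
  let ?Z = "hyperrange M S"
  have cs: "csubspace M" using M by (simp add: closed_subspace_def)
  have fin: "fin_dim (kernel_on M S)" using F by (simp add: upper_semi_fredholm_on_def)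
  have Z: "closed_subspace ?Z" by (rule closed_subspace_hyperrange[OF S M F])
  have SZ: "S ` ?Z = ?Z" by (rule hyperrange_image[OF S cs M(2) fin])
  have clZ: "closed ?Z" using Z by (simp add: closed_subspace_def)
  have clSZ: "closed (S ` ?Z)" using clZ by (simp only: SZ)
  obtain C where C: "C > 0" "\<And>y. y \<in> ?Z \<Longrightarrow> \<exists>x\<in>?Z. S x = y \<and> norm x \<le> C * norm y"
    using open_mapping_on[OF bounded_op_imp_bounded_linear[OF S] closed_subspace_imp_subspace[OF Z] clZ clSZ]
    unfolding SZ by blast
  have "0 \<in> kernel_on M S \<inter> ?Z"
    using csubspace_kernel_on[OF S cs] csubspace_hyperrange[OF S cs] by (simp add: csubspace_def)
  then obtain x0 where x0: "x0 \<in> ?Z" "S x0 = 0" "x0 \<noteq> 0"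
    using ntriv by (auto simp: kernel_on_def)
  obtain r f where f: "r > 0" "c_analytic_on f (ball 0 r)"
    "\<forall>z\<in>ball 0 r. f z \<in> M \<and> f z \<noteq> 0 \<and> shift_op S z (f z) = 0"
    by (rule eigenvector_family_of_backward_orbit[OF S M(1) hyperrange_subset C x0])
  show thesis
  proof (rule that[OF f(1)])
    fix z assume "cmod z < r"
    then have "f z \<in> kernel_on M (shift_op S z)" "f z \<noteq> 0" using f(3) by (auto simp: kernel_on_def)
    then show "\<not> inj_on (shift_op S z) M"
      using inj_on_iff_kernel_on[OF bounded_op_shift[OF S] cs] by blast
  qed
qed

text \<open>The set of \<open>\<mu> \<noteq> 0\<close> with \<open>N(T - \<mu>) \<inter> R\<^sup>\<infinity>(T - \<mu>) = 0\<close> and its complement in the punctured plane are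
  both open, and large \<open>\<mu>\<close> belong to the former.\<close>

lemma kernel_hyperrange_trivial_of_riesz:
  fixes T :: "'a::complex_banach \<Rightarrow> 'a"
  assumes T: "bounded_op T" and N: "closed_subspace N" "T ` N \<subseteq> N"
    and F: "\<And>\<mu>. \<mu> \<noteq> 0 \<Longrightarrow> upper_semi_fredholm_on N (shift_op T \<mu>)" and \<mu>: "\<mu> \<noteq> 0"
  shows "kernel_on N (shift_op T \<mu>) \<inter> hyperrange N (shift_op T \<mu>) = {0}"
proof -
  have cs: "csubspace N" using N by (simp add: closed_subspace_def)
  define P where "P \<mu> \<longleftrightarrow> kernel_on N (shift_op T \<mu>) \<inter> hyperrange N (shift_op T \<mu>) = {0}" for \<mu>
  define A where "A = {\<mu>. \<mu> \<noteq> 0 \<and> P \<mu>}"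
  define B where "B = {\<mu>. \<mu> \<noteq> 0 \<and> \<not> P \<mu>}"
  have Sh: "bounded_op (shift_op T \<mu>)" for \<mu> by (rule bounded_op_shift[OF T])
  have inv: "shift_op T \<mu> ` N \<subseteq> N" for \<mu> by (rule csubspace_invariant_shift[OF cs N(2)])
  have inj_P: "P \<mu>" if "inj_on (shift_op T \<mu>) N" for \<mu>
  proof -
    have "kernel_on N (shift_op T \<mu>) = {0}" using that inj_on_iff_kernel_on[OF Sh cs] by blast
    moreover have "0 \<in> hyperrange N (shift_op T \<mu>)"
      using csubspace_hyperrange[OF Sh cs] by (simp add: csubspace_def)
    ultimately show ?thesis by (auto simp: P_def)
  qed
  have shift: "shift_op T w = shift_op (shift_op T \<mu>) (w - \<mu>)" for w \<mu> by (simp add: shift_op_shift_op)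
  have "\<exists>e>0. ball \<mu> e \<subseteq> A" if "\<mu> \<in> A" for \<mu>
  proof -
    have \<mu>: "\<mu> \<noteq> 0" "P \<mu>" using that by (auto simp: A_def)
    obtain e where e: "e > 0" "\<And>z. z \<noteq> 0 \<Longrightarrow> cmod z < e \<Longrightarrow> inj_on (shift_op (shift_op T \<mu>) z) N"
      using punctured_inj_on[OF Sh N(1) inv F[OF \<mu>(1)]] \<mu>(2) unfolding P_def by blast
    \<comment> \<open>Capping the radius by the modulus of \<mu> keeps the ball away from 0.\<close>
    have "w \<in> A" if w: "w \<in> ball \<mu> (min e (cmod \<mu>))" for w
    proof (cases "w = \<mu>")
      case False
      then have "w - \<mu> \<noteq> 0" by simp
      moreover have "cmod (w - \<mu>) < e" using w by (simp add: dist_norm norm_minus_commute)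
      ultimately have "inj_on (shift_op T w) N" using e(2) shift[of w \<mu>] by simp
      moreover have "w \<noteq> 0" using w by (auto simp: dist_norm)
      ultimately show ?thesis using inj_P by (simp add: A_def)
    qed (use \<mu> in \<open>simp add: A_def\<close>)
    then show ?thesis using e(1) \<mu>(1) by (intro exI[of _ "min e (cmod \<mu>)"]) auto
  qed
  then have opA: "open A" by (simp add: open_contains_ball)
  have "\<exists>e>0. ball \<mu> e \<subseteq> B" if "\<mu> \<in> B" for \<mu>
  proof -
    have \<mu>: "\<mu> \<noteq> 0" "\<not> P \<mu>" using that by (auto simp: B_def)
    obtain e where e: "e > 0" "\<And>z. cmod z < e \<Longrightarrow> \<not> inj_on (shift_op (shift_op T \<mu>) z) N"
      using nearby_not_inj_on[OF Sh N(1) inv F[OF \<mu>(1)]] \<mu>(2) unfolding P_def by blast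
    \<comment> \<open>If P held at w, the shifts at all points close to w would be injective, except
      perhaps at w. The point w + t below is such a point, yet it is still within e of \<mu>, where
      no shift is injective.\<close>
    have nP: "\<not> P w" if w: "w \<noteq> 0" "cmod (w - \<mu>) < e" for w
    proof
      assume "P w"
      then obtain d where d: "d > 0" "\<And>z. z \<noteq> 0 \<Longrightarrow> cmod z < d \<Longrightarrow> inj_on (shift_op (shift_op T w) z) N"
        using punctured_inj_on[OF Sh N(1) inv F[OF w(1)] \<open>P w\<close>[unfolded P_def]] by metis
      define m where "m = min d (e - cmod (w - \<mu>))"
      have m: "m > 0" "m \<le> d" "m \<le> e - cmod (w - \<mu>)" using d(1) w(2) by (simp_all add: m_def)
      define t where "t = m / 2"
      have t: "t > 0" "t < d" "cmod (w - \<mu>) + t < e" using m by (simp_all add: t_def)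
      have "inj_on (shift_op (shift_op T w) (of_real t)) N" using t by (intro d(2)) simp_all
      moreover have "shift_op (shift_op T w) (of_real t) = shift_op (shift_op T \<mu>) (w - \<mu> + of_real t)"
        by (simp add: shift_op_shift_op)
      moreover have "cmod (w - \<mu> + of_real t) < e"
        using norm_triangle_ineq[of "w - \<mu>" "of_real t"] t by simp
      ultimately show False using e(2) by simp
    qed
    have "ball \<mu> (min e (cmod \<mu>)) \<subseteq> B"
    proof
      fix w assume w: "w \<in> ball \<mu> (min e (cmod \<mu>))"
      then have "w \<noteq> 0" by (auto simp: dist_norm)
      moreover have "cmod (w - \<mu>) < e" using w by (simp add: dist_norm norm_minus_commute)
      ultimately show "w \<in> B" using nP by (simp add: B_def)
    qed
    then show ?thesis using e(1) \<mu>(1) by (intro exI[of _ "min e (cmod \<mu>)"]) auto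
  qed
  then have opB: "open B" by (simp add: open_contains_ball)
  obtain K where K: "\<And>x. norm (T x) \<le> norm x * K" using T by (auto simp: bounded_op_def)
  \<comment> \<open>An eigenvalue cannot exceed the bound \<open>K\<close> in modulus; |K| + 1 is
    nonzero and larger than \<open>K\<close> whatever the sign of \<open>K\<close>.\<close>
  define w where "w = complex_of_real (\<bar>K\<bar> + 1)"
  have w0: "w \<noteq> 0" unfolding w_def using abs_ge_zero[of K] by (simp only: of_real_eq_0_iff)
  have "x = 0" if "x \<in> kernel_on N (shift_op T w)" for x
  proof -
    have "T x = cscale w x" using that by (simp add: kernel_on_def shift_op_def)
    then have "norm (T x) = (\<bar>K\<bar> + 1) * norm x" by (simp add: norm_cscale w_def del: of_real_add)
    with K[of x] have "(\<bar>K\<bar> + 1) * norm x \<le> K * norm x" by (simp add: mult.commute)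
    then have "(\<bar>K\<bar> + 1 - K) * norm x \<le> 0" by (simp add: algebra_simps)
    moreover have "\<bar>K\<bar> + 1 - K > 0" by linarith
    ultimately show ?thesis by (simp add: mult_le_0_iff)
  qed
  moreover have "0 \<in> kernel_on N (shift_op T w)"
    using csubspace_kernel_on[OF Sh cs] by (simp add: csubspace_def)
  ultimately have "inj_on (shift_op T w) N" using inj_on_iff_kernel_on[OF Sh cs] by blast
  then have wA: "w \<in> A" using inj_P w0 by (simp add: A_def)
  have "connected (- {0::complex})" by (rule connected_punctured_universe) simp
  moreover have "A \<inter> B \<inter> (- {0}) = {}" "- {0} \<subseteq> A \<union> B" by (auto simp: A_def B_def)
  ultimately have "A \<inter> (- {0}) = {} \<or> B \<inter> (- {0}) = {}" using opA opB connectedD by blast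
  then have "\<mu> \<notin> B" using wA w0 \<mu> by blast
  then show ?thesis using \<mu> by (simp add: B_def P_def)
qed

section \<open>Splitting off the generalized kernel of an upper semi-Browder operator\<close>

text \<open>Kernels of all powers are intersected with Y, which preserves finite dimension and the
  equality of consecutive kernels; the image stays closed by the semi-Fredholm argument.\<close>

lemma upper_semi_browder_on_subspace:
  assumes S: "bounded_op S" and M: "closed_subspace M" and B: "upper_semi_browder_on M S"
    and Y: "closed_subspace Y" "Y \<subseteq> M"
  shows "upper_semi_browder_on Y S"
proof -
  have F: "upper_semi_fredholm_on M S" using B by (simp add: upper_semi_browder_on_def)
  have ker: "kernel_on Y f = kernel_on M f \<inter> Y" for f using Y(2) by (auto simp: kernel_on_def)
  have "fin_dim (kernel_on Y S)"
    using F fin_dim_subset[of "kernel_on M S" "kernel_on Y S"] by (simp add: ker upper_semi_fredholm_on_def)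
  moreover have "closed (S ` Y)"
    using closed_subspace_image_upper_semi_fredholm[OF S M F Y] by (simp add: closed_subspace_def)
  moreover have "finite_ascent_on Y S"
    using B unfolding upper_semi_browder_on_def finite_ascent_on_def ker by auto
  ultimately show ?thesis by (simp add: upper_semi_browder_on_def upper_semi_fredholm_on_def)
qed

lemma bounded_below_on_imp_upper_semi_browder_on:
  assumes S: "bounded_op S" and M: "csubspace M" and B: "bounded_below_on M S"
  shows "upper_semi_browder_on M S"
proof -
  have K: "kernel_on M S = {0}" using B inj_on_iff_kernel_on[OF S M] by (simp add: bounded_below_on_def)
  have "kernel_on M (S ^^ 0) = kernel_on M (S ^^ Suc 0)"
    using K M by (auto simp: kernel_on_def csubspace_def)
  then have "finite_ascent_on M S" unfolding finite_ascent_on_def by blast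
  moreover have "fin_dim (kernel_on M S)" unfolding fin_dim_iff by (intro exI[of _ "{}"]) (simp add: K)
  ultimately show ?thesis using B
    by (simp add: upper_semi_browder_on_def upper_semi_fredholm_on_def bounded_below_on_def)
qed

text \<open>Splits off one Jordan chain \<open>e, Se, \<dots>, S\<^sup>k e\<close> ending in the kernel. The chain is taken as long
  as possible, so \<open>S\<^sup>k e\<close> lies outside \<open>R(S\<^sup>k\<^sup>+\<^sup>1)\<close> and is detected by a functional \<open>\<phi>\<close> vanishing
  there; the functionals \<open>\<phi> \<circ> S\<^sup>j\<close>, \<open>j \<le> k\<close>, cut out an invariant complement.\<close>

lemma jordan_chain_complement:
  fixes S :: "'a::complex_banach \<Rightarrow> 'a"
  assumes S: "bounded_op S" and M: "closed_subspace M" "S ` M \<subseteq> M" and B: "upper_semi_browder_on M S"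
    and ker: "kernel_on M S \<noteq> {0}"
  obtains M' W where "closed_subspace M'" "S ` M' \<subseteq> M'" "csubspace W" "fin_dim W" "S ` W \<subseteq> W"
    "M' \<inter> W = {0}" "M' + W = M" "kernel_on M' S \<subset> kernel_on M S"
proof -
  have cs: "csubspace M" and sub: "cvs.subspace M"
    using M by (auto simp: closed_subspace_def csubspace_iff)
  have F: "upper_semi_fredholm_on M S" and asc: "finite_ascent_on M S"
    using B by (auto simp: upper_semi_browder_on_def)
  let ?P = "\<lambda>p. kernel_on M S \<inter> (S ^^ p) ` M = {0}"
  obtain p where "?P p" using finite_ascent_on_imp[OF S cs asc] by blast
  then have LP: "?P (LEAST p. ?P p)" by (rule LeastI)
  have "\<not> ?P 0" using ker by (auto simp: kernel_on_def)
  \<comment> \<open>The least exponent is positive because the kernel is nonzero; its predecessor k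
    is the last one for which N(S) still meets R(S^k) nontrivially.\<close>
  then obtain k where k: "(LEAST p. ?P p) = Suc k" using LP by (metis not0_implies_Suc)
  have "\<not> ?P k" using not_less_Least[of k ?P] k by simp
  moreover have "0 \<in> kernel_on M S \<inter> (S ^^ k) ` M"
    using csubspace_kernel_on[OF S cs] csubspace_image_funpow[OF S cs] by (simp add: csubspace_def)
  ultimately obtain v where v: "v \<in> kernel_on M S" "v \<in> (S ^^ k) ` M" "v \<noteq> 0" by blast
  then obtain e where e: "e \<in> M" "v = (S ^^ k) e" by blast
  have "v \<notin> (S ^^ Suc k) ` M" using LP v unfolding k by blast
  then obtain \<phi> :: "'a \<Rightarrow> complex" where \<phi>: "bounded_linear \<phi>" "\<And>c x. \<phi> (cscale c x) = c * \<phi> x"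
    "\<And>y. y \<in> (S ^^ Suc k) ` M \<Longrightarrow> \<phi> y = 0" "\<phi> v = 1"
    using hahn_banach_separating[OF closed_subspace_image_funpow[OF S M F]] by metis
  have Sn: "bounded_op (S ^^ n)" for n by (rule bounded_op_funpow[OF S])
  have SnM: "(S ^^ n) x \<in> M" if "x \<in> M" for n x using funpow_invariant[OF M(2)] that by blast
  have vanish: "(S ^^ n) e = 0" if n: "n > k" for n
  proof -
    obtain m where m: "n = m + Suc k" using n by (metis Suc_leI add.commute le_Suc_ex)
    have "(S ^^ n) e = (S ^^ m) (S v)" unfolding m funpow_add by (simp add: e(2))
    then show ?thesis using v(1) by (simp add: kernel_on_def bounded_op_zero[OF Sn])
  qed
  \<comment> \<open>Passing from x to S x shifts these conditions by one. Only the last leaves the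
    list, and it becomes \<phi>(S^(k+1) x) = 0, which holds on all of M.\<close>
  define M' where "M' = {x \<in> M. \<forall>j\<le>k. \<phi> ((S ^^ j) x) = 0}"
  define w where "w c = (\<Sum>j\<le>k. cscale (c j) ((S ^^ j) e))" for c
  define W where "W = range w"
  have M'M: "M' \<subseteq> M" by (auto simp: M'_def)
  have \<phi>0: "\<phi> 0 = 0" and \<phi>add: "\<phi> (x + y) = \<phi> x + \<phi> y" and \<phi>diff: "\<phi> (x - y) = \<phi> x - \<phi> y" for x y
    using \<phi>(1) linear_simps(1,2,3) by blast+
  have "csubspace M'"
    using cs by (auto simp: M'_def csubspace_def \<phi>0 \<phi>add \<phi>(2) bounded_op_zero[OF Sn] bounded_op_add[OF Sn]
        bounded_op_cscale[OF Sn])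
  moreover have "closed M'"
  proof -
    have "closed {x. \<phi> ((S ^^ j) x) = 0}" for j
    proof (rule closed_Collect_eq)
      have "bounded_linear (\<lambda>x. \<phi> ((S ^^ j) x))"
        using bounded_linear_compose[OF \<phi>(1) bounded_op_imp_bounded_linear[OF Sn]] .
      then show "continuous_on UNIV (\<lambda>x. \<phi> ((S ^^ j) x))" by (rule linear_continuous_on)
    qed (rule continuous_on_const)
    then have "closed (M \<inter> (\<Inter>j\<in>{..k}. {x. \<phi> ((S ^^ j) x) = 0}))"
      using M(1) by (intro closed_Int closed_INT ballI) (auto simp: closed_subspace_def)
    moreover have "M' = M \<inter> (\<Inter>j\<in>{..k}. {x. \<phi> ((S ^^ j) x) = 0})" by (auto simp: M'_def)
    ultimately show ?thesis by simp
  qed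
  ultimately have clM': "closed_subspace M'" by (simp add: closed_subspace_def)
  have invM': "S ` M' \<subseteq> M'"
  proof
    fix y assume "y \<in> S ` M'"
    then obtain x where x: "x \<in> M" "\<And>j. j \<le> k \<Longrightarrow> \<phi> ((S ^^ j) x) = 0" "y = S x" by (auto simp: M'_def)
    have "\<phi> ((S ^^ j) y) = 0" if "j \<le> k" for j
    proof -
      have eq: "(S ^^ j) y = (S ^^ Suc j) x" by (simp add: x(3) funpow_swap1)
      show ?thesis
      proof (cases "j = k")
        case True
        then show ?thesis using \<phi>(3) x(1) unfolding eq by blast
      next
        case False
        then show ?thesis using x(2)[of "Suc j"] that unfolding eq by simp
      qed
    qed
    then show "y \<in> M'" using x M(2) by (auto simp: M'_def)
  qed
  have addw: "w c + w d = w (\<lambda>j. c j + d j)" for c d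
    by (simp add: w_def cscale_add_left sum.distrib)
  have scw: "cscale a (w c) = w (\<lambda>j. a * c j)" for a c
    by (simp add: w_def cvs.scale_sum_right cscale_cscale)
  have w0: "w (\<lambda>_. 0) = 0" by (simp add: w_def)
  have csW: "csubspace W"
    unfolding csubspace_def
  proof (intro conjI ballI allI)
    show "0 \<in> W" unfolding W_def using w0 by (metis rangeI)
    fix x assume "x \<in> W"
    then obtain c where c: "x = w c" by (auto simp: W_def)
    show "cscale a x \<in> W" for a unfolding c scw W_def by (rule rangeI)
    fix y assume "y \<in> W"
    then obtain d where d: "y = w d" by (auto simp: W_def)
    show "x + y \<in> W" unfolding c d addw W_def by (rule rangeI)
  qed
  have "w c \<in> cvs.span ((\<lambda>j. (S ^^ j) e) ` {..k})" for c
    unfolding w_def by (intro cvs.span_sum cvs.span_scale cvs.span_base) auto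
  then have finW: "fin_dim W"
    unfolding fin_dim_iff W_def by (intro exI[of _ "(\<lambda>j. (S ^^ j) e) ` {..k}"]) auto
  have WM: "W \<subseteq> M"
    unfolding W_def w_def using sub SnM e(1) by (auto intro!: cvs.subspace_sum cvs.subspace_scale)
  have eW: "(S ^^ j) e \<in> W" for j
  proof (cases "j \<le> k")
    case True
    have "w (\<lambda>i. if i = j then 1 else 0) = (\<Sum>i\<le>k. if i = j then (S ^^ i) e else 0)"
      unfolding w_def by (intro sum.cong) (auto simp: cscale_one)
    also have "\<dots> = (S ^^ j) e" using True by simp
    finally show ?thesis unfolding W_def by (metis rangeI)
  next
    case False
    then show ?thesis using vanish csW by (simp add: csubspace_def)
  qed
  have subW: "cvs.subspace W" using csW by (simp add: csubspace_iff)
  have invW: "S ` W \<subseteq> W"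
  proof -
    have "S (w c) = (\<Sum>j\<le>k. cscale (c j) ((S ^^ Suc j) e))" for c
      unfolding w_def by (simp add: bounded_op_sum[OF S] bounded_op_cscale[OF S])
    moreover have "(\<Sum>j\<le>k. cscale (c j) ((S ^^ Suc j) e)) \<in> W" for c
      using subW eW by (intro cvs.subspace_sum cvs.subspace_scale)
    ultimately show ?thesis unfolding W_def by auto
  qed
  have "x = 0" if x: "x \<in> M'" "x \<in> W" for x
  proof -
    obtain c where c: "x = w c" using x(2) by (auto simp: W_def)
    \<comment> \<open>A triangular system: S^(k-j) kills the chain vectors after the j-th, the
      earlier coefficients are 0 by induction, and \<phi> reads off c(j) because \<phi>(v) =
      1.\<close>
    have "j \<le> k \<Longrightarrow> c j = 0" for j
    proof (induction j rule: less_induct)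
      case (less j)
      have "(S ^^ (k - j)) (w c) = (\<Sum>i\<le>k. cscale (c i) ((S ^^ (k - j + i)) e))"
        unfolding w_def by (simp add: bounded_op_sum[OF Sn] bounded_op_cscale[OF Sn] funpow_add)
      also have "\<dots> = (\<Sum>i\<le>k. if i = j then cscale (c j) v else 0)"
      proof (intro sum.cong refl)
        fix i assume i: "i \<in> {..k}"
        show "cscale (c i) ((S ^^ (k - j + i)) e) = (if i = j then cscale (c j) v else 0)"
        proof (cases i j rule: linorder_cases)
          case less': less
          then show ?thesis using less.IH[of i] i by simp
        next
          case equal
          then show ?thesis using less.prems by (simp add: e(2))
        next
          case greater
          then have "k - j + i > k" using less.prems by simp
          then show ?thesis using greater by (simp add: vanish)
        qed
      qed
      also have "\<dots> = cscale (c j) v" using less.prems by simp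
      finally have "\<phi> ((S ^^ (k - j)) (w c)) = c j" using \<phi>(2,4) by simp
      then show ?case using x(1) by (simp add: M'_def c)
    qed
    then show "x = 0" by (simp add: c w_def)
  qed
  then have int: "M' \<inter> W = {0}"
    using csW clM' by (auto simp: closed_subspace_def csubspace_def)
  \<comment> \<open>Back substitution from i = k downwards, where \<open>m\<close> counts the
    conditions already met. Subtracting a multiple of S^m e repairs condition k - m and leaves the
    later ones alone, because S^(i+m) e = 0 for i > k - m.\<close>
  have "\<exists>u\<in>W. \<forall>i. Suc k - m \<le> i \<and> i \<le> k \<longrightarrow> \<phi> ((S ^^ i) (x - u)) = 0" if "m \<le> Suc k" for m x
    using that
  proof (induction m)
    case 0
    then show ?case using csW by (intro bexI[of _ 0]) (auto simp: csubspace_def)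
  next
    case (Suc m)
    then obtain u where u: "u \<in> W" "\<And>i. Suc k - m \<le> i \<Longrightarrow> i \<le> k \<Longrightarrow> \<phi> ((S ^^ i) (x - u)) = 0" by auto
    define c where "c = \<phi> ((S ^^ (k - m)) (x - u))"
    define u' where "u' = u + cscale c ((S ^^ m) e)"
    have "u' \<in> W" unfolding u'_def using subW u(1) eW by (intro cvs.subspace_add cvs.subspace_scale)
    moreover have "\<phi> ((S ^^ i) (x - u')) = 0" if i: "Suc k - Suc m \<le> i" "i \<le> k" for i
    proof -
      have "(S ^^ i) (x - u') = (S ^^ i) ((x - u) - cscale c ((S ^^ m) e))"
        by (simp add: u'_def algebra_simps)
      also have "\<dots> = (S ^^ i) (x - u) - cscale c ((S ^^ (i + m)) e)"
        by (simp add: bounded_op_diff[OF Sn] bounded_op_cscale[OF Sn] funpow_add)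
      finally have *: "\<phi> ((S ^^ i) (x - u')) = \<phi> ((S ^^ i) (x - u)) - c * \<phi> ((S ^^ (i + m)) e)"
        by (simp add: \<phi>diff \<phi>(2))
      show ?thesis
      proof (cases "i = k - m")
        case True
        then have "i + m = k" using Suc.prems by simp
        then show ?thesis using \<phi>(4) unfolding * by (simp add: e(2) c_def True)
      next
        case False
        then have "Suc k - m \<le> i" "i + m > k" using i Suc.prems by auto
        then show ?thesis unfolding * using u(2) i(2) by (simp add: vanish \<phi>0)
      qed
    qed
    ultimately show ?case by blast
  qed
  from this[of "Suc k"] have dec: "\<exists>u\<in>W. \<forall>i\<le>k. \<phi> ((S ^^ i) (x - u)) = 0" for x by simp
  have "M' + W = M"
  proof
    show "M' + W \<subseteq> M" using M'M WM sub by (auto simp: set_plus_def intro!: cvs.subspace_add)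
    show "M \<subseteq> M' + W"
    proof
      fix x assume x: "x \<in> M"
      obtain u where u: "u \<in> W" "\<forall>i\<le>k. \<phi> ((S ^^ i) (x - u)) = 0" using dec by blast
      have "x - u \<in> M" using x u(1) WM sub cvs.subspace_diff by blast
      then have "x - u \<in> M'" using u(2) by (simp add: M'_def)
      then have "x - u + u \<in> M' + W" using u(1) by (rule set_plus_intro)
      then show "x \<in> M' + W" by simp
    qed
  qed
  moreover have "kernel_on M' S \<subset> kernel_on M S"
  proof -
    have "v \<in> W" using eW e(2) by simp
    then have "v \<notin> M'" using int v(3) by blast
    then show ?thesis using v(1) M'M by (auto simp: kernel_on_def)
  qed
  ultimately show thesis using that clM' invM' csW finW invW int by blast
qed

text \<open>Splitting off a Jordan chain shrinks the kernel, so its dimension drives the induction;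
  once it is {0}, closed range gives bounded below. The chains accumulate in one finite-dimensional
  invariant W.\<close>

lemma upper_semi_browder_decomposition:
  fixes S :: "'a::complex_banach \<Rightarrow> 'a"
  assumes S: "bounded_op S" and M: "closed_subspace M" "S ` M \<subseteq> M" and B: "upper_semi_browder_on M S"
  shows "\<exists>M1 W. closed_subspace M1 \<and> S ` M1 \<subseteq> M1 \<and> csubspace W \<and> fin_dim W \<and> S ` W \<subseteq> W \<and>
    M1 \<inter> W = {0} \<and> M1 + W = M \<and> bounded_below_on M1 S"
  using M B
proof (induction "cvs.dim (kernel_on M S)" arbitrary: M rule: less_induct)
  case less
  have cs: "csubspace M" using less.prems by (simp add: closed_subspace_def)
  have F: "upper_semi_fredholm_on M S" using less.prems by (simp add: upper_semi_browder_on_def)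
  show ?case
  proof (cases "kernel_on M S = {0}")
    case True
    then have "bounded_below_on M S"
      using F inj_on_iff_kernel_on[OF S cs] by (simp add: bounded_below_on_def upper_semi_fredholm_on_def)
    moreover have "M \<inter> {0} = {0}" "M + {0} = M" using cs by (auto simp: set_plus_def csubspace_def)
    moreover have "csubspace {0}" by (simp add: csubspace_def)
    moreover have "fin_dim {0}" unfolding fin_dim_iff by (intro exI[of _ "{}"]) simp
    ultimately show ?thesis
      using less.prems by (intro exI[of _ M] exI[of _ "{0}"]) (simp add: bounded_op_zero[OF S])
  next
    case False
    obtain M' W' where M': "closed_subspace M'" "S ` M' \<subseteq> M'" and W': "csubspace W'" "fin_dim W'" "S ` W' \<subseteq> W'"
      and sum: "M' \<inter> W' = {0}" "M' + W' = M" and ker: "kernel_on M' S \<subset> kernel_on M S"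
      by (rule jordan_chain_complement[OF S less.prems False])
    have M'M: "M' \<subseteq> M"
    proof
      fix x assume "x \<in> M'"
      then have "x + 0 \<in> M' + W'" using W'(1) by (intro set_plus_intro) (auto simp: csubspace_def)
      then show "x \<in> M" using sum(2) by simp
    qed
    have dim: "cvs.dim (kernel_on M' S) < cvs.dim (kernel_on M S)"
      using ker F csubspace_kernel_on[OF S] cs M'(1)
      by (intro fin_dim_psubset_dim) (auto simp: upper_semi_fredholm_on_def closed_subspace_def)
    obtain M1 W where M1: "closed_subspace M1" "S ` M1 \<subseteq> M1" and W: "csubspace W" "fin_dim W" "S ` W \<subseteq> W"
      and sum1: "M1 \<inter> W = {0}" "M1 + W = M'" and bb: "bounded_below_on M1 S"
      using less.hyps[OF dim M' upper_semi_browder_on_subspace[OF S less.prems(1,3) M'(1) M'M]] by blast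
    have in_M': "a + b \<in> M'" if "a \<in> M1" "b \<in> W" for a b using sum1(2) that by (metis set_plus_intro)
    have "x = 0" if x: "x \<in> M1" "x \<in> W + W'" for x
    proof -
      obtain a b where ab: "x = a + b" "a \<in> W" "b \<in> W'" using x(2) by (rule set_plus_elim)
      have "x - a \<in> M'"
        using in_M'[OF x(1), of "- a"] ab(2) W(1) cvs.subspace_neg[of W a] by (simp add: csubspace_iff)
      then have "b = 0" using ab sum(1) by auto
      then show ?thesis using ab x(1) sum1(1) by auto
    qed
    moreover have "0 \<in> M1" "0 \<in> W + W'"
      using M1(1) csubspace_plus[OF W(1) W'(1)] by (auto simp: closed_subspace_def csubspace_def)
    ultimately have "M1 \<inter> (W + W') = {0}" by blast
    moreover have "M1 + (W + W') = M" using sum sum1 by (simp add: add.assoc[symmetric])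
    moreover have "S ` (W + W') \<subseteq> W + W'"
    proof
      fix y assume "y \<in> S ` (W + W')"
      then obtain a b where "y = S a + S b" "a \<in> W" "b \<in> W'"
        by (auto simp: set_plus_def bounded_op_add[OF S])
      then show "y \<in> W + W'" using W(3) W'(3) by (auto intro!: set_plus_intro)
    qed
    ultimately show ?thesis
      using M1 bb csubspace_plus[OF W(1) W'(1)] fin_dim_plus[OF W(2) W'(2)] by blast
  qed
qed

section \<open>Operators reduced by a direct sum\<close>

lemma fredholm_on_iff:
  "fredholm_on N S \<longleftrightarrow> fin_dim (kernel_on N S) \<and> closed (S ` N) \<and>
    (\<exists>F. finite F \<and> F \<subseteq> N \<and> N \<subseteq> S ` N + cspan F)"
proof -
  have "{y + z | y z. y \<in> A \<and> z \<in> B} = A + B" for A B :: "'a::complex_banach set"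
    unfolding set_plus_def by blast
  then show ?thesis unfolding fredholm_on_def by simp
qed

text \<open>The sum is assumed closed but need not be the whole space: besides M and N, the locale
  is applied to N and a finite-dimensional W.\<close>

locale reduced_op =
  fixes S :: "'a::complex_banach \<Rightarrow> 'a" and A B :: "'a set"
  assumes S: "bounded_op S" and A: "closed_subspace A" and B: "closed_subspace B"
    and Int: "A \<inter> B = {0}" and closed_sum: "closed (A + B)"
    and invA: "S ` A \<subseteq> A" and invB: "S ` B \<subseteq> B"
begin

lemma csA: "csubspace A" and csB: "csubspace B"
  using A B by (simp_all add: closed_subspace_def)

lemma csAB: "csubspace (A + B)"
  by (rule csubspace_plus[OF csA csB])

lemma subset_sum: "A \<subseteq> A + B" "B \<subseteq> A + B"
  using set_zero_plus2[of B A] set_zero_plus2[of A B] csA csB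
  by (auto simp: csubspace_def add.commute)

lemma unique:
  assumes "a \<in> A" "b \<in> B" "a' \<in> A" "b' \<in> B" "a + b = a' + b'"
  shows "a = a'" "b = b'"
proof -
  have "a - a' = b' - b" using assms(5) by (simp add: algebra_simps)
  moreover have "a - a' \<in> A" using assms csA cvs.subspace_diff by (auto simp: csubspace_iff)
  moreover have "b' - b \<in> B" using assms csB cvs.subspace_diff by (auto simp: csubspace_iff)
  ultimately have "a - a' \<in> A \<inter> B" by simp
  then show "a = a'" unfolding Int by simp
  then show "b = b'" using assms(5) by simp
qed

lemma image_plus: "S ` (A + B) = S ` A + S ` B"
proof (intro equalityI subsetI)
  fix y assume "y \<in> S ` (A + B)"
  then obtain a b where "y = S a + S b" "a \<in> A" "b \<in> B"
    by (auto simp: bounded_op_add[OF S] elim!: set_plus_elim)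
  then show "y \<in> S ` A + S ` B" by (simp add: set_plus_intro)
next
  fix y assume "y \<in> S ` A + S ` B"
  then obtain a b where "y = S (a + b)" "a \<in> A" "b \<in> B"
    by (auto simp: bounded_op_add[OF S] elim!: set_plus_elim)
  then show "y \<in> S ` (A + B)" by (simp add: set_plus_intro)
qed

lemma kernel_plus: "kernel_on (A + B) S = kernel_on A S + kernel_on B S"
proof (intro equalityI subsetI)
  fix x assume "x \<in> kernel_on (A + B) S"
  then have "x \<in> A + B" "S x = 0" by (auto simp: kernel_on_def)
  then obtain a b where ab: "x = a + b" "a \<in> A" "b \<in> B" by (meson set_plus_elim)
  have "S a + S b = 0 + 0" using \<open>S x = 0\<close> by (simp add: ab(1) bounded_op_add[OF S])
  moreover have "S a \<in> A" "S b \<in> B" "0 \<in> A" "0 \<in> B"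
    using ab csA csB invA invB by (auto simp: csubspace_def)
  ultimately have "S a = 0" "S b = 0" using unique by blast+
  then show "x \<in> kernel_on A S + kernel_on B S"
    using ab by (auto simp: kernel_on_def intro!: set_plus_intro)
next
  fix x assume "x \<in> kernel_on A S + kernel_on B S"
  then obtain a b where "x = a + b" "a \<in> kernel_on A S" "b \<in> kernel_on B S" by (rule set_plus_elim)
  then show "x \<in> kernel_on (A + B) S"
    by (auto simp: kernel_on_def bounded_op_add[OF S] intro!: set_plus_intro)
qed

lemma inj_on_plus:
  assumes "inj_on S A" "inj_on S B"
  shows "inj_on S (A + B)"
  using assms kernel_plus inj_on_iff_kernel_on[OF S csA] inj_on_iff_kernel_on[OF S csB]
    inj_on_iff_kernel_on[OF S csAB] by simp

lemma closed_image_plus: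
  assumes "closed (S ` A)" "closed (S ` B)"
  shows "closed (S ` (A + B))"
  unfolding image_plus
  by (rule closed_plus_of_direct[of A B])
    (use A B in \<open>simp_all add: closed_subspace_def csubspace_imp_subspace csubspace_image S
      Int closed_sum assms invA invB\<close>)

lemma upper_semi_fredholm_plus:
  assumes "upper_semi_fredholm_on A S" "upper_semi_fredholm_on B S"
  shows "upper_semi_fredholm_on (A + B) S"
  using assms closed_image_plus fin_dim_plus[of "kernel_on A S" "kernel_on B S"]
  by (simp add: upper_semi_fredholm_on_def kernel_plus)

lemma bounded_below_plus:
  assumes "bounded_below_on A S" "bounded_below_on B S"
  shows "bounded_below_on (A + B) S"
  using assms closed_image_plus inj_on_plus by (simp add: bounded_below_on_def)

lemma inv_plus: "S ` (A + B) \<subseteq> A + B"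
  unfolding image_plus using invA invB by (rule set_plus_mono2)

text \<open>By uniqueness of components, a vector in the kernel and the hyperrange of the sum has
  each component in the kernel and the hyperrange of its summand, where finite ascent makes it
  0.\<close>

lemma upper_semi_browder_plus:
  assumes A': "upper_semi_browder_on A S" and B': "upper_semi_browder_on B S"
  shows "upper_semi_browder_on (A + B) S"
proof -
  have F: "upper_semi_fredholm_on (A + B) S"
    using assms upper_semi_fredholm_plus by (simp add: upper_semi_browder_on_def)
  have trivA: "kernel_on A S \<inter> hyperrange A S = {0}" and trivB: "kernel_on B S \<inter> hyperrange B S = {0}"
    using kernel_hyperrange_trivial[OF S csA] kernel_hyperrange_trivial[OF S csB] assms
    by (simp_all add: upper_semi_browder_on_def)
  have "x = 0" if x: "x \<in> kernel_on (A + B) S" "x \<in> hyperrange (A + B) S" for x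
  proof -
    obtain a b where ab: "x = a + b" "a \<in> kernel_on A S" "b \<in> kernel_on B S"
      using x(1) unfolding kernel_plus by (rule set_plus_elim)
    have ab': "a \<in> A" "b \<in> B" using ab by (auto simp: kernel_on_def)
    have "a \<in> (S ^^ n) ` A \<and> b \<in> (S ^^ n) ` B" for n
    proof -
      obtain y where y: "y \<in> A + B" "x = (S ^^ n) y" using x(2) unfolding hyperrange_def by blast
      obtain a' b' where y': "y = a' + b'" "a' \<in> A" "b' \<in> B" using y(1) by (rule set_plus_elim)
      have "a + b = (S ^^ n) a' + (S ^^ n) b'"
        using y y' ab(1) bounded_op_add[OF bounded_op_funpow[OF S]] by simp
      moreover have "(S ^^ n) a' \<in> A" "(S ^^ n) b' \<in> B"
        using y' funpow_invariant[OF invA] funpow_invariant[OF invB] by blast+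
      ultimately have "a = (S ^^ n) a'" "b = (S ^^ n) b'" using unique ab' by blast+
      then show ?thesis using y' by blast
    qed
    then have "a \<in> kernel_on A S \<inter> hyperrange A S" "b \<in> kernel_on B S \<inter> hyperrange B S"
      using ab by (auto simp: hyperrange_def)
    then show ?thesis unfolding trivA trivB using ab(1) by simp
  qed
  moreover have "0 \<in> kernel_on (A + B) S \<inter> hyperrange (A + B) S"
    using csubspace_kernel_on[OF S csAB] csubspace_hyperrange[OF S csAB] by (simp add: csubspace_def)
  ultimately have "kernel_on (A + B) S \<inter> hyperrange (A + B) S = {0}" by blast
  then have "finite_ascent_on (A + B) S"
    using finite_ascent_onI[OF S csAB inv_plus] F by (simp add: upper_semi_fredholm_on_def)
  then show ?thesis using F by (simp add: upper_semi_browder_on_def)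
qed

lemma fredholm_plus:
  assumes A': "fredholm_on A S" and B': "fredholm_on B S"
  shows "fredholm_on (A + B) S"
proof -
  obtain F where F: "finite F" "F \<subseteq> A" "A \<subseteq> S ` A + cspan F"
    using A' unfolding fredholm_on_iff by auto
  obtain G where G: "finite G" "G \<subseteq> B" "B \<subseteq> S ` B + cspan G"
    using B' unfolding fredholm_on_iff by auto
  have "A + B \<subseteq> (S ` A + cspan F) + (S ` B + cspan G)" using F(3) G(3) by (rule set_plus_mono2)
  also have "\<dots> = S ` (A + B) + (cspan F + cspan G)" unfolding image_plus by (simp add: ac_simps)
  also have "cspan F + cspan G = cspan (F \<union> G)"
    using F(1) G(1) by (auto simp: cspan_eq_span cvs.span_Un set_plus_def)
  finally have "\<exists>H. finite H \<and> H \<subseteq> A + B \<and> A + B \<subseteq> S ` (A + B) + cspan H"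
    using F G subset_sum by (intro exI[of _ "F \<union> G"]) auto
  moreover have "fin_dim (kernel_on (A + B) S)"
    unfolding kernel_plus using A' B' by (intro fin_dim_plus) (simp_all add: fredholm_on_def)
  moreover have "closed (S ` (A + B))"
    using A' B' by (intro closed_image_plus) (simp_all add: fredholm_on_def)
  ultimately show ?thesis by (simp add: fredholm_on_iff)
qed

end

lemma reduced_op_shift: "reduced_op S A B \<Longrightarrow> reduced_op (shift_op S \<mu>) A B"
  unfolding reduced_op_def closed_subspace_def
  by (simp add: bounded_op_shift csubspace_invariant_shift)

lemma reducing_pair_iff:
  assumes "bounded_op T"
  shows "reducing_pair T M N \<longleftrightarrow> reduced_op T M N \<and> M + N = UNIV"
proof -
  have "(\<forall>x. \<exists>m\<in>M. \<exists>n\<in>N. x = m + n) \<longleftrightarrow> M + N = UNIV"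
    unfolding set_plus_def by (simp add: set_eq_iff)
  then show ?thesis using assms by (auto simp: reducing_pair_def reduced_op_def)
qed

lemma funpow_eq_on:
  assumes "\<And>x. x \<in> M \<Longrightarrow> S x = S' x" "S ` M \<subseteq> M" "x \<in> M"
  shows "(S ^^ n) x = (S' ^^ n) x"
proof (induction n)
  case (Suc n)
  have "(S ^^ n) x \<in> M" using funpow_invariant[OF assms(2)] assms(3) by blast
  then show ?case using Suc assms(1) by simp
qed simp

text \<open>The two congruence lemmas trade T + P and T P for the simpler operators they induce on
  the kernel and the range of P.\<close>

lemma upper_semi_browder_on_cong:
  assumes eq: "\<And>x. x \<in> M \<Longrightarrow> S x = S' x" and inv: "S ` M \<subseteq> M"
  shows "upper_semi_browder_on M S \<longleftrightarrow> upper_semi_browder_on M S'"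
proof -
  have ker: "kernel_on M (S ^^ n) = kernel_on M (S' ^^ n)" for n
    using funpow_eq_on[OF eq inv] by (auto simp: kernel_on_def)
  have "kernel_on M S = kernel_on M S'" using ker[of 1] by simp
  moreover have "S ` M = S' ` M" using eq by (rule image_cong[OF refl])
  ultimately show ?thesis
    unfolding upper_semi_browder_on_def upper_semi_fredholm_on_def finite_ascent_on_def ker by simp
qed

lemma fredholm_on_cong:
  assumes eq: "\<And>x. x \<in> M \<Longrightarrow> S x = S' x"
  shows "fredholm_on M S \<longleftrightarrow> fredholm_on M S'"
proof -
  have "kernel_on M S = kernel_on M S'" using eq by (auto simp: kernel_on_def)
  moreover have "S ` M = S' ` M" using eq by (rule image_cong[OF refl])
  ultimately show ?thesis unfolding fredholm_on_def by simp
qed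

text \<open>A basis of W spans a complement to any range. This is what lets a finite-dimensional
  invariant summand join the Riesz part.\<close>

lemma fredholm_on_fin_dim:
  assumes S: "bounded_op S" and W: "csubspace W" "fin_dim W"
  shows "fredholm_on W S"
proof -
  obtain F where F: "finite F" "W = cvs.span F" using fin_dim_basis[OF W(2,1)] by blast
  obtain G where G: "finite G" "W \<subseteq> cvs.span G" using W(2) by (auto simp: fin_dim_iff)
  have "S ` W \<subseteq> cvs.span (S ` G)"
    using G(2) module_hom.span_image[OF bounded_op_linear[OF S, unfolded linear_iff_module_hom], of G]
    by blast
  then have "fin_dim (S ` W)" using G(1) fin_dim_iff by blast
  then have "closed (S ` W)"
    using closed_subspace_fin_dim[OF csubspace_image[OF S W(1)]] by (simp add: closed_subspace_def)
  moreover have "fin_dim (kernel_on W S)" using W(2) by (rule fin_dim_subset) (auto simp: kernel_on_def)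
  moreover have "F \<subseteq> W" unfolding F(2) by (rule cvs.span_superset)
  moreover have "W \<subseteq> S ` W + cspan F"
  proof
    fix x assume "x \<in> W"
    moreover have "0 \<in> S ` W" using csubspace_image[OF S W(1)] by (simp add: csubspace_def)
    ultimately have "0 + x \<in> S ` W + cspan F" using F by (intro set_plus_intro) (simp_all add: cspan_eq_span)
    then show "x \<in> S ` W + cspan F" by simp
  qed
  ultimately show ?thesis using F(1) fredholm_on_iff by blast
qed

section \<open>Perturbation and the identity theorem\<close>

lemma bounded_below_on_shift:
  fixes T :: "'a::complex_banach \<Rightarrow> 'a"
  assumes T: "bounded_op T" and M: "closed_subspace M" and bb: "bounded_below_on M T"
  obtains e where "e > 0" "\<And>z. cmod z < e \<Longrightarrow> bounded_below_on M (shift_op T z)"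
proof -
  have cs: "csubspace M" and cl: "closed M" using M by (auto simp: closed_subspace_def)
  have inj: "inj_on T M" and clR: "closed (T ` M)" using bb by (auto simp: bounded_below_on_def)
  obtain C where C: "C > 0" "\<And>y. y \<in> T ` M \<Longrightarrow> \<exists>x\<in>M. T x = y \<and> norm x \<le> C * norm y"
    using open_mapping_on[OF bounded_op_imp_bounded_linear[OF T] closed_subspace_imp_subspace[OF M] cl clR]
    by blast
  have low: "norm x \<le> C * norm (T x)" if x: "x \<in> M" for x
  proof -
    obtain y where "y \<in> M" "T y = T x" "norm y \<le> C * norm (T x)" using C(2)[of "T x"] x by blast
    then show ?thesis using inj x by (metis inj_onD)
  qed
  show thesis
  \<comment> \<open>The lower bound of T on M is 1/C; half of it absorbs z and the other half
    survives.\<close>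
  proof (rule that[of "1 / (2 * C)"])
    show "1 / (2 * C) > 0" using C(1) by simp
    fix z assume z: "cmod z < 1 / (2 * C)"
    have low': "1 / (2 * C) * norm x \<le> norm (shift_op T z x)" if x: "x \<in> M" for x
    proof -
      have "cmod z * norm x \<le> 1 / (2 * C) * norm x" using z by (intro mult_right_mono) auto
      moreover have "norm x / C \<le> norm (T x)" using low[OF x] C(1) by (simp add: field_simps)
      moreover have "norm (T x) - cmod z * norm x \<le> norm (shift_op T z x)"
        unfolding shift_op_def using norm_triangle_ineq2[of "T x" "cscale z x"] by (simp only: norm_cscale)
      moreover have "norm x / C = 1 / (2 * C) * norm x + 1 / (2 * C) * norm x" by (simp add: field_simps)
      ultimately show ?thesis by linarith
    qed
    have sh: "bounded_op (shift_op T z)" by (rule bounded_op_shift[OF T])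
    have "x = 0" if "x \<in> kernel_on M (shift_op T z)" for x
      using low'[of x] that C(1) by (auto simp: kernel_on_def divide_le_0_iff)
    moreover have "0 \<in> kernel_on M (shift_op T z)"
      using csubspace_kernel_on[OF sh cs] by (simp add: csubspace_def)
    ultimately have "inj_on (shift_op T z) M" using inj_on_iff_kernel_on[OF sh cs] by blast
    moreover have "complete (shift_op T z ` M)"
    proof (rule complete_isometric_image)
      show "0 < 1 / (2 * C)" using C(1) by simp
      show "subspace M" by (rule closed_subspace_imp_subspace[OF M])
      show "bounded_linear (shift_op T z)" by (rule bounded_op_imp_bounded_linear[OF sh])
      show "complete M" using cl by (simp add: complete_eq_closed)
    qed (use low' in blast)
    ultimately show "bounded_below_on M (shift_op T z)"
      by (simp add: bounded_below_on_def complete_eq_closed)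
  qed
qed

lemma riesz_on_upper_semi_fredholm_on:
  "riesz_on N T \<Longrightarrow> \<mu> \<noteq> 0 \<Longrightarrow> upper_semi_fredholm_on N (shift_op T \<mu>)"
  by (simp add: riesz_on_def fredholm_on_def upper_semi_fredholm_on_def)

lemma riesz_on_upper_semi_browder_on:
  assumes T: "bounded_op T" and N: "closed_subspace N" "T ` N \<subseteq> N" and R: "riesz_on N T" and \<mu>: "\<mu> \<noteq> 0"
  shows "upper_semi_browder_on N (shift_op T \<mu>)"
proof -
  have cs: "csubspace N" using N by (simp add: closed_subspace_def)
  have F: "upper_semi_fredholm_on N (shift_op T \<mu>)" by (rule riesz_on_upper_semi_fredholm_on[OF R \<mu>])
  have "finite_ascent_on N (shift_op T \<mu>)"
    using finite_ascent_onI[OF bounded_op_shift[OF T] cs csubspace_invariant_shift[OF cs N(2)]]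
      kernel_hyperrange_trivial_of_riesz[OF T N riesz_on_upper_semi_fredholm_on[OF R] \<mu>] F
    by (simp add: upper_semi_fredholm_on_def)
  then show ?thesis using F by (simp add: upper_semi_browder_on_def)
qed

text \<open>A kernel may remain at \<mu> itself, but finite ascent makes the shifts injective on a
  punctured disc around \<mu>.\<close>

lemma inj_on_near_upper_semi_browder:
  assumes T: "bounded_op T" and N: "closed_subspace N" "T ` N \<subseteq> N"
    and B: "upper_semi_browder_on N (shift_op T \<mu>)" and e: "e > 0"
  obtains z where "z \<noteq> \<mu>" "cmod (z - \<mu>) < e" "inj_on (shift_op T z) N"
proof -
  have cs: "csubspace N" using N by (simp add: closed_subspace_def)
  have Sh: "bounded_op (shift_op T \<mu>)" by (rule bounded_op_shift[OF T])
  have triv: "kernel_on N (shift_op T \<mu>) \<inter> hyperrange N (shift_op T \<mu>) = {0}"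
    using kernel_hyperrange_trivial[OF Sh cs] B by (simp add: upper_semi_browder_on_def)
  have F: "upper_semi_fredholm_on N (shift_op T \<mu>)" using B by (simp add: upper_semi_browder_on_def)
  obtain d where d: "d > 0" "\<And>z. z \<noteq> 0 \<Longrightarrow> cmod z < d \<Longrightarrow> inj_on (shift_op (shift_op T \<mu>) z) N"
    using punctured_inj_on[OF Sh N(1) csubspace_invariant_shift[OF cs N(2)] F triv] by metis
  define t where "t = complex_of_real (min d e / 2)"
  have t: "t \<noteq> 0" "cmod t < d" "cmod t < e" using d(1) e by (auto simp: t_def min_def)
  show thesis
  proof (rule that[of "\<mu> + t"])
    show "inj_on (shift_op T (\<mu> + t)) N" using d(2)[OF t(1,2)] by (simp add: shift_op_shift_op)
  qed (use t in auto)
qed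

text \<open>A noninjective Kato restriction has eigenvectors for every z in a disc around 0, so one
  injective shift in each disc excludes it.\<close>

lemma bounded_below_on_of_kato_on:
  assumes T: "bounded_op T" and M: "closed_subspace M" "T ` M \<subseteq> M" and kato: "kato_on M T"
    and near: "\<And>e. e > 0 \<Longrightarrow> \<exists>z. cmod z < e \<and> inj_on (shift_op T z) M"
  shows "bounded_below_on M T"
proof -
  have "inj_on T M"
  proof (rule ccontr)
    assume "\<not> inj_on T M"
    then obtain r f where f: "r > 0" "\<forall>z\<in>ball 0 r. f z \<in> M \<and> f z \<noteq> 0 \<and> shift_op T z (f z) = 0"
      using kato_eigenvector_family[OF T M kato] by metis
    obtain z where z: "cmod z < r" "inj_on (shift_op T z) M" using near[OF f(1)] by blast
    have "f z \<in> kernel_on M (shift_op T z)" "f z \<noteq> 0" using f(2) z(1) by (auto simp: kernel_on_def)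
    then show False
      using inj_on_iff_kernel_on[OF bounded_op_shift[OF T], of M] M(1) z(2)
      by (auto simp: closed_subspace_def)
  qed
  then show ?thesis using kato by (simp add: bounded_below_on_def kato_on_def)
qed

text \<open>If f(w) were nonzero, a functional \<phi> with \<phi>(f(w)) = 1 would make \<phi> after
  f a scalar holomorphic function whose zeros accumulate at the centre, contrary to the classical
  identity theorem.\<close>

lemma c_analytic_on_zero:
  fixes f :: "complex \<Rightarrow> 'a::complex_banach"
  assumes f: "c_analytic_on f (ball a r)" and r: "r > 0"
    and zeros: "\<And>e. e > 0 \<Longrightarrow> \<exists>z. z \<noteq> a \<and> cmod (z - a) < e \<and> f z = 0" and w: "w \<in> ball a r"
  shows "f w = 0"
proof (rule ccontr)
  assume nz: "f w \<noteq> 0"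
  have "closed_subspace {0::'a}" by (simp add: closed_subspace_def csubspace_def)
  then obtain \<phi> :: "'a \<Rightarrow> complex" where \<phi>: "bounded_linear \<phi>" "\<And>c x. \<phi> (cscale c x) = c * \<phi> x"
    "\<And>y. y \<in> {0} \<Longrightarrow> \<phi> y = 0" "\<phi> (f w) = 1"
    using hahn_banach_separating[of "{0}" "f w"] nz by (metis singletonD)
  have hol: "(\<phi> \<circ> f) holomorphic_on ball a r"
    unfolding holomorphic_on_def
  proof
    fix z assume "z \<in> ball a r"
    then obtain v where v: "(f has_derivative (\<lambda>h. cscale h v)) (at z)"
      using f unfolding c_analytic_on_def by blast
    have "((\<lambda>x. \<phi> (f x)) has_derivative (\<lambda>h. \<phi> (cscale h v))) (at z)"
      by (rule bounded_linear.has_derivative[OF \<phi>(1) v])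
    moreover have "(\<lambda>h. \<phi> (cscale h v)) = (*) (\<phi> v)" by (simp add: fun_eq_iff \<phi>(2))
    ultimately have "((\<phi> \<circ> f) has_field_derivative \<phi> v) (at z)"
      unfolding has_field_derivative_def o_def by simp
    then show "(\<phi> \<circ> f) field_differentiable at z within ball a r"
      using field_differentiable_at_within field_differentiable_def by blast
  qed
  have "(\<phi> \<circ> f) w = 0"
  proof (rule analytic_continuation[OF hol, where U = "{z \<in> ball a r. f z = 0}" and \<xi> = a])
    show "a islimpt {z \<in> ball a r. f z = 0}"
      unfolding islimpt_approachable
    proof (intro allI impI)
      fix e :: real assume "e > 0"
      then obtain z where "z \<noteq> a" "cmod (z - a) < min e r" "f z = 0" using zeros[of "min e r"] r by auto
      then show "\<exists>z\<in>{z \<in> ball a r. f z = 0}. z \<noteq> a \<and> dist z a < e"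
        by (intro bexI[of _ z]) (auto simp: dist_norm norm_minus_commute)
    qed
  qed (use r w \<phi>(3) in auto)
  then show False using \<phi>(4) by simp
qed

section \<open>The equivalence\<close>

text \<open>On the kernel of the projection P the operator T P - \<mu> reduces to this
  scalar.\<close>

lemma fredholm_on_scale:
  assumes M: "closed_subspace M" and \<mu>: "\<mu> \<noteq> 0"
  shows "fredholm_on M (\<lambda>x. - cscale \<mu> x)"
proof -
  have sub: "cvs.subspace M" using M by (simp add: closed_subspace_def csubspace_iff)
  have "kernel_on M (\<lambda>x. - cscale \<mu> x) = {0}"
    using \<mu> cvs.subspace_0[OF sub] by (auto simp: kernel_on_def)
  moreover have "(\<lambda>x. - cscale \<mu> x) ` M = M"
  proof (intro equalityI subsetI)
    fix y assume "y \<in> (\<lambda>x. - cscale \<mu> x) ` M"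
    then show "y \<in> M" using cvs.subspace_neg[OF sub] cvs.subspace_scale[OF sub] by auto
  next
    fix y assume "y \<in> M"
    then show "y \<in> (\<lambda>x. - cscale \<mu> x) ` M"
      using \<mu> cvs.subspace_scale[OF sub] cvs.subspace_neg[OF sub]
      by (intro image_eqI[of _ _ "cscale (- inverse \<mu>) y"]) (simp_all add: cscale_cscale cscale_one)
  qed
  moreover have "fin_dim {0::'a}" unfolding fin_dim_iff by (intro exI[of _ "{}"]) simp
  moreover have "M \<subseteq> M + cspan {}"
    by (simp add: cspan_eq_span set_plus_def)
  ultimately show ?thesis
    using M unfolding fredholm_on_iff closed_subspace_def by (metis empty_subsetI finite.emptyI)
qed

context
  fixes T :: "'a::complex_banach \<Rightarrow> 'a" and M N :: "'a set"
  assumes T: "bounded_op T" and red: "reducing_pair T M N"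
begin

lemma reduced_op_T: "reduced_op T M N"
  using red reducing_pair_iff[OF T] by blast

lemma plus_UNIV: "M + N = UNIV"
  using red reducing_pair_iff[OF T] by blast

lemma closed_subspaces: "closed_subspace M" "closed_subspace N" "T ` M \<subseteq> M" "T ` N \<subseteq> N"
  using red by (simp_all add: reducing_pair_def)

lemma reduced_op_shift_T: "reduced_op (shift_op T z) M N"
  by (rule reduced_op_shift[OF reduced_op_T])

text \<open>Riesz operators need not be injective near \<open>0\<close>, but their nonzero eigenvalues are isolated.\<close>

lemma inj_on_near_zero_of_riesz:
  assumes "riesz_on N T" and e: "e > 0"
  obtains z where "z \<noteq> 0" "cmod z < e" "inj_on (shift_op T z) N"
proof -
  define w where "w = complex_of_real (e / 2)"
  have w: "w \<noteq> 0" "cmod w = e / 2" using e by (simp_all add: w_def)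
  have B: "upper_semi_browder_on N (shift_op T w)"
    by (rule riesz_on_upper_semi_browder_on[OF T closed_subspaces(2,4) assms(1) w(1)])
  have e2: "e / 2 > 0" using e by simp
  obtain z where z: "cmod (z - w) < e / 2" "inj_on (shift_op T z) N"
    using inj_on_near_upper_semi_browder[OF T closed_subspaces(2,4) B e2] by blast
  have "z \<noteq> 0" using z(1) w(2) by auto
  moreover have "cmod z < e" using norm_triangle_ineq[of "z - w" w] z(1) w(2) by simp
  ultimately show thesis using z(2) that by blast
qed

text \<open>At a small nonzero z that is no eigenvalue on N, the part on M is bounded below by
  perturbation, and the part on N is injective with closed range by the Riesz property.\<close>

lemma not_interior_sigma_ap:
  assumes bb: "bounded_below_on M T" and R: "riesz_on N T"
  shows "0 \<notin> interior (sigma_ap T)"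
proof
  assume "0 \<in> interior (sigma_ap T)"
  then obtain r where r: "r > 0" "ball 0 r \<subseteq> sigma_ap T" using mem_interior by blast
  obtain e where e: "e > 0" "\<And>z. cmod z < e \<Longrightarrow> bounded_below_on M (shift_op T z)"
    by (rule bounded_below_on_shift[OF T closed_subspaces(1) bb]) blast
  have "min r e > 0" using r e by simp
  then obtain z where z: "z \<noteq> 0" "cmod z < min r e" "inj_on (shift_op T z) N"
    by (rule inj_on_near_zero_of_riesz[OF R])
  have "bounded_below_on N (shift_op T z)"
    using z(3) riesz_on_upper_semi_fredholm_on[OF R z(1)]
    by (simp add: bounded_below_on_def upper_semi_fredholm_on_def)
  then have "bounded_below_on (M + N) (shift_op T z)"
    using reduced_op.bounded_below_plus[OF reduced_op_shift_T] e(2) z(2) by simp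
  moreover have "z \<in> sigma_ap T" using r(2) z(2) by auto
  ultimately show False by (simp add: plus_UNIV sigma_ap_def)
qed

text \<open>The shifts are injective on the whole space at points accumulating at 0. There f must
  vanish, and the identity theorem does the rest.\<close>

lemma SVEP_at_zero:
  assumes bb: "bounded_below_on M T" and R: "riesz_on N T"
  shows "SVEP_at T 0"
  unfolding SVEP_at_def
proof (intro allI impI ballI, elim conjE)
  fix r :: real and f :: "complex \<Rightarrow> 'a" and w :: complex
  assume r: "r > 0" and f: "c_analytic_on f (ball 0 r)" and eig: "\<forall>\<mu>\<in>ball 0 r. shift_op T \<mu> (f \<mu>) = 0"
    and w: "w \<in> ball 0 r"
  obtain e where e: "e > 0" "\<And>z. cmod z < e \<Longrightarrow> bounded_below_on M (shift_op T z)"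
    by (rule bounded_below_on_shift[OF T closed_subspaces(1) bb]) blast
  show "f w = 0"
  proof (rule c_analytic_on_zero[OF f r _ w])
    fix d :: real assume "d > 0"
    then have "min d (min r e) > 0" using r e by simp
    then obtain z where z: "z \<noteq> 0" "cmod z < min d (min r e)" "inj_on (shift_op T z) N"
      by (rule inj_on_near_zero_of_riesz[OF R])
    have "inj_on (shift_op T z) M" using e(2) z(2) by (simp add: bounded_below_on_def)
    then have "inj_on (shift_op T z) (M + N)"
      using reduced_op.inj_on_plus[OF reduced_op_shift_T] z(3) by blast
    moreover have "shift_op T z (f z) = shift_op T z 0"
      using eig z(2) by (simp add: bounded_op_zero[OF bounded_op_shift[OF T]])
    ultimately have "f z = 0" by (simp add: plus_UNIV inj_eq)
    then show "\<exists>z. z \<noteq> 0 \<and> cmod (z - 0) < d \<and> f z = 0" using z by auto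
  qed
qed

text \<open>Eigenvalues on N do no harm here: a Riesz operator minus any z \<noteq> 0 is upper
  semi-Browder.\<close>

lemma not_islimpt_sigma_B_plus:
  assumes bb: "bounded_below_on M T" and R: "riesz_on N T"
  shows "\<not> 0 islimpt sigma_B_plus T"
proof
  assume lim: "0 islimpt sigma_B_plus T"
  obtain e where e: "e > 0" "\<And>z. cmod z < e \<Longrightarrow> bounded_below_on M (shift_op T z)"
    by (rule bounded_below_on_shift[OF T closed_subspaces(1) bb]) blast
  obtain z where z: "z \<in> sigma_B_plus T" "z \<noteq> 0" "dist z 0 < e"
    using lim e(1) unfolding islimpt_approachable by blast
  have "upper_semi_browder_on M (shift_op T z)"
    using bounded_below_on_imp_upper_semi_browder_on[OF bounded_op_shift[OF T]] closed_subspaces(1) e(2) z(3)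
    by (simp add: closed_subspace_def)
  moreover have "upper_semi_browder_on N (shift_op T z)"
    by (rule riesz_on_upper_semi_browder_on[OF T closed_subspaces(2,4) R z(2)])
  ultimately have "upper_semi_browder_on (M + N) (shift_op T z)"
    by (rule reduced_op.upper_semi_browder_plus[OF reduced_op_shift_T])
  then show False using z(1) by (simp add: plus_UNIV sigma_B_plus_def)
qed

section \<open>Projections and rearranged decompositions\<close>

text \<open>\<open>P\<close> projects onto the Riesz side N along M. It is bounded by
  \<open>direct_sum_bound\<close> and commutes with T because components are unique and both
  summands are invariant.\<close>

lemma reducing_projection:
  obtains P where "bounded_op P" "\<forall>x\<in>M. P x = 0" "\<forall>x\<in>N. P x = x"
    "\<forall>x. P (P x) = P x" "\<forall>x. P (T x) = T (P x)"
proof -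
  interpret reduced_op T M N by (rule reduced_op_T)
  obtain C where C: "C > 0" "\<And>a b. a \<in> M \<Longrightarrow> b \<in> N \<Longrightarrow> norm (a, b) \<le> C * norm (a + b)"
    using direct_sum_bound[of M N] closed_subspace_imp_subspace A B Int closed_sum
    by (metis closed_subspace_def)
  have "\<exists>m n. m \<in> M \<and> n \<in> N \<and> x = m + n" for x
    using plus_UNIV set_plus_elim[of x M N] by (metis UNIV_I)
  then obtain Q P where Q: "\<And>x. Q x \<in> M" and P: "\<And>x. P x \<in> N" and QP: "\<And>x. x = Q x + P x" by metis
  have P_eq: "P x = n" if "x = m + n" "m \<in> M" "n \<in> N" for x m n
    using unique(2)[of "Q x" "P x" m n] Q P QP that by metis
  have sM: "cvs.subspace M" and sN: "cvs.subspace N" using csA csB by (simp_all add: csubspace_iff)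
  have Padd: "P (x + y) = P x + P y" for x y
  proof (rule P_eq)
    show "x + y = (Q x + Q y) + (P x + P y)" using QP[of x] QP[of y] by (simp add: algebra_simps)
  qed (use Q P cvs.subspace_add sM sN in blast)+
  have Psc: "P (cscale c x) = cscale c (P x)" for c x
  proof (rule P_eq)
    show "cscale c x = cscale c (Q x) + cscale c (P x)"
      using QP[of x] by (simp flip: cscale_add_right)
  qed (use Q P cvs.subspace_scale sM sN in blast)+
  have "norm (P x) \<le> norm x * C" for x
  proof -
    have "norm (P x) \<le> norm (Q x, P x)" by (rule norm_snd_le)
    also have "\<dots> \<le> C * norm x" using C(2)[OF Q P, of x x] QP[of x] by simp
    finally show ?thesis by (simp add: mult.commute)
  qed
  then have bP: "bounded_op P" unfolding bounded_op_def clinear_op_def using Padd Psc by blast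
  have PN: "P x = x" if "x \<in> N" for x
    using that cvs.subspace_0[OF sM] by (intro P_eq[of x 0 x]) simp_all
  show thesis
  proof (rule that[OF bP])
    show "\<forall>x\<in>M. P x = 0" using P_eq[of _ _ 0] cvs.subspace_0[OF sN] by simp
    show "\<forall>x. P (P x) = P x" using PN[OF P] by blast
    show "\<forall>x\<in>N. P x = x" using PN by blast
    show "\<forall>x. P (T x) = T (P x)"
    proof (intro allI P_eq)
      fix x
      show "T x = T (Q x) + T (P x)" using QP[of x] by (simp flip: bounded_op_add[OF T])
      show "T (Q x) \<in> M" "T (P x) \<in> N" using Q P invA invB by blast+
    qed
  qed
qed

text \<open>T + P is T on M and T + 1 on N, and T P is 0 on M and T on N, so each claim is checked
  on the summands. T + 1 is the shift of the Riesz part by the nonzero number -1.\<close>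

lemma projection_of_browder_riesz:
  assumes bb: "upper_semi_browder_on M T" and R: "riesz_on N T"
  shows "\<exists>P. bounded_op P \<and> (\<forall>x. P (P x) = P x) \<and> (\<forall>x. P (T x) = T (P x)) \<and>
    upper_semi_browder_on UNIV (\<lambda>x. T x + P x) \<and> riesz_on UNIV (\<lambda>x. T (P x))"
proof -
  interpret reduced_op T M N by (rule reduced_op_T)
  obtain P where P: "bounded_op P" "\<forall>x\<in>M. P x = 0" "\<forall>x\<in>N. P x = x"
    "\<forall>x. P (P x) = P x" "\<forall>x. P (T x) = T (P x)"
    by (rule reducing_projection)
  have 1: "reduced_op (\<lambda>x. T x + P x) M N"
  proof
    show "(\<lambda>x. T x + P x) ` M \<subseteq> M" using P(2) invA by auto
    show "(\<lambda>x. T x + P x) ` N \<subseteq> N"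
      using P(3) invB csB by (auto simp: csubspace_def image_subset_iff)
  qed (use A B Int closed_sum bounded_op_plus[OF T P(1)] in auto)
  have "upper_semi_browder_on M (\<lambda>x. T x + P x)"
    using upper_semi_browder_on_cong[of M T "\<lambda>x. T x + P x"] bb P(2) invA by simp
  moreover have "upper_semi_browder_on N (\<lambda>x. T x + P x)"
  proof -
    have "upper_semi_browder_on N (shift_op T (- 1))"
      by (rule riesz_on_upper_semi_browder_on[OF T B invB R]) simp
    moreover have "shift_op T (- 1) x = T x + P x" if "x \<in> N" for x
      using P(3) that by (simp add: shift_op_def cvs.scale_minus_left cscale_one)
    ultimately show ?thesis
      using upper_semi_browder_on_cong[of N "shift_op T (- 1)" "\<lambda>x. T x + P x"]
        csubspace_invariant_shift[OF csB invB] by blast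
  qed
  ultimately have "upper_semi_browder_on (M + N) (\<lambda>x. T x + P x)"
    by (rule reduced_op.upper_semi_browder_plus[OF 1])
  moreover have "riesz_on UNIV (\<lambda>x. T (P x))"
    unfolding riesz_on_def
  proof (intro allI impI)
    fix \<mu> :: complex assume \<mu>: "\<mu> \<noteq> 0"
    have "reduced_op (\<lambda>x. T (P x)) M N"
    proof
      show "(\<lambda>x. T (P x)) ` M \<subseteq> M" using P(2) csA by (auto simp: bounded_op_zero[OF T] csubspace_def)
      show "(\<lambda>x. T (P x)) ` N \<subseteq> N" using P(3) invB by auto
    qed (use A B Int closed_sum bounded_op_compose[OF T P(1)] in auto)
    then have 2: "reduced_op (shift_op (\<lambda>x. T (P x)) \<mu>) M N" by (rule reduced_op_shift)
    have "fredholm_on M (shift_op (\<lambda>x. T (P x)) \<mu>)"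
      using fredholm_on_scale[OF A \<mu>] fredholm_on_cong[of M "\<lambda>x. - cscale \<mu> x" "shift_op (\<lambda>x. T (P x)) \<mu>"]
      by (simp add: shift_op_def P(2) bounded_op_zero[OF T])
    moreover have "fredholm_on N (shift_op (\<lambda>x. T (P x)) \<mu>)"
      using R \<mu> fredholm_on_cong[of N "shift_op T \<mu>" "shift_op (\<lambda>x. T (P x)) \<mu>"]
      by (simp add: shift_op_def P(3) riesz_on_def)
    ultimately have "fredholm_on (M + N) (shift_op (\<lambda>x. T (P x)) \<mu>)"
      by (rule reduced_op.fredholm_plus[OF 2])
    then show "fredholm_on UNIV (shift_op (\<lambda>x. T (P x)) \<mu>)" by (simp add: plus_UNIV)
  qed
  ultimately show ?thesis using P(1,4,5) by (auto simp: plus_UNIV)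
qed

text \<open>Rebracketing: (M1 + W) + N becomes M1 + (W + N), where W is the finite-dimensional piece
  of M.\<close>

lemma bounded_below_riesz_of_browder_riesz:
  assumes bb: "upper_semi_browder_on M T" and R: "riesz_on N T"
  shows "\<exists>M N. reducing_pair T M N \<and> bounded_below_on M T \<and> riesz_on N T"
proof -
  interpret reduced_op T M N by (rule reduced_op_T)
  obtain M1 W where M1: "closed_subspace M1" "T ` M1 \<subseteq> M1" "bounded_below_on M1 T"
    and W: "csubspace W" "fin_dim W" "T ` W \<subseteq> W" and sum: "M1 \<inter> W = {0}" "M1 + W = M"
    using upper_semi_browder_decomposition[OF T A invA bb] by blast
  have M1M: "M1 \<subseteq> M" "W \<subseteq> M"
    using set_zero_plus2[of W M1] set_zero_plus2[of M1 W] M1(1) W(1) sum(2)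
    by (auto simp: closed_subspace_def csubspace_def add.commute)
  have NW: "closed_subspace (W + N)"
    using closed_subspace_plus_fin_dim[OF B W(1,2)] by (simp add: add.commute)
  have WN: "reduced_op T W N"
  proof
    show "closed_subspace W" by (rule closed_subspace_fin_dim[OF W(1,2)])
    show "W \<inter> N = {0}" using M1M(2) Int W(1) csB by (auto simp: csubspace_def)
    show "closed (W + N)" using NW by (simp add: closed_subspace_def)
  qed (use T B W(3) invB in auto)
  have "x = 0" if x: "x \<in> M1" "x \<in> W + N" for x
  proof -
    obtain a b where ab: "x = a + b" "a \<in> W" "b \<in> N" using x(2) by (rule set_plus_elim)
    have "x + 0 = a + b" "x \<in> M" "a \<in> M" "0 \<in> N"
      using ab x(1) M1M csB by (auto simp: csubspace_def)
    then have "x = a" using unique(1) ab(3) by blast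
    then show ?thesis using ab(2) x(1) sum(1) by auto
  qed
  moreover have "0 \<in> M1" "0 \<in> W + N"
    using M1(1) NW by (auto simp: closed_subspace_def csubspace_def)
  ultimately have int: "M1 \<inter> (W + N) = {0}" by blast
  have univ: "M1 + (W + N) = UNIV" using sum(2) plus_UNIV by (simp add: add.assoc[symmetric])
  have "reduced_op T M1 (W + N)"
    by unfold_locales (use T M1 NW int univ reduced_op.inv_plus[OF WN] in auto)
  then have "reducing_pair T M1 (W + N)" using univ reducing_pair_iff[OF T] by blast
  moreover have "riesz_on (W + N) T"
    unfolding riesz_on_def
  proof (intro allI impI)
    fix \<mu> :: complex assume \<mu>: "\<mu> \<noteq> 0"
    show "fredholm_on (W + N) (shift_op T \<mu>)"
      using reduced_op.fredholm_plus[OF reduced_op_shift[OF WN]]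
        fredholm_on_fin_dim[OF bounded_op_shift[OF T] W(1,2)] R \<mu> by (simp add: riesz_on_def)
  qed
  ultimately show ?thesis using M1(3) by blast
qed

end

text \<open>The kernel and the range of P are the two summands. On the range T P - \<mu> agrees with
  T - \<mu>; it commutes with P, so P carries a finite spanning set for a complement of its range in
  the whole space to one inside N.\<close>

lemma browder_riesz_of_projection:
  fixes T P :: "'a::complex_banach \<Rightarrow> 'a"
  assumes T: "bounded_op T" and P: "bounded_op P" and idem: "\<And>x. P (P x) = P x"
    and comm: "\<And>x. P (T x) = T (P x)"
    and B: "upper_semi_browder_on UNIV (\<lambda>x. T x + P x)" and R: "riesz_on UNIV (\<lambda>x. T (P x))"
  shows "\<exists>M N. reducing_pair T M N \<and> upper_semi_browder_on M T \<and> riesz_on N T"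
proof -
  define M where "M = {x. P x = 0}"
  define N where "N = {x. P x = x}"
  have contP: "continuous_on UNIV P"
    by (rule linear_continuous_on[OF bounded_op_imp_bounded_linear[OF P]])
  have M: "closed_subspace M"
    unfolding closed_subspace_def M_def csubspace_def
    using closed_Collect_eq[OF contP continuous_on_const]
    by (simp add: bounded_op_zero[OF P] bounded_op_add[OF P] bounded_op_cscale[OF P])
  have N: "closed_subspace N"
    unfolding closed_subspace_def N_def csubspace_def
    using closed_Collect_eq[OF contP continuous_on_id]
    by (simp add: bounded_op_zero[OF P] bounded_op_add[OF P] bounded_op_cscale[OF P])
  have invM: "T ` M \<subseteq> M" and invN: "T ` N \<subseteq> N"
    by (auto simp: M_def N_def comm bounded_op_zero[OF T])
  have red: "reducing_pair T M N"
    unfolding reducing_pair_def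
  proof (intro conjI M N invM invN allI)
    show "M \<inter> N = {0}" by (auto simp: M_def N_def bounded_op_zero[OF P])
    fix x
    have "x - P x \<in> M" "P x \<in> N" "x = (x - P x) + P x"
      by (simp_all add: M_def N_def bounded_op_diff[OF P] idem)
    then show "\<exists>m\<in>M. \<exists>n\<in>N. x = m + n" by blast
  qed
  have UNIV: "closed_subspace (UNIV :: 'a set)" by (simp add: closed_subspace_def csubspace_def)
  have "upper_semi_browder_on M (\<lambda>x. T x + P x)"
    by (rule upper_semi_browder_on_subspace[OF bounded_op_plus[OF T P] UNIV B M]) simp
  then have BM: "upper_semi_browder_on M T"
    using upper_semi_browder_on_cong[of M T "\<lambda>x. T x + P x"] invM by (simp add: M_def)
  have "riesz_on N T"
    unfolding riesz_on_def
  proof (intro allI impI)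
    fix \<mu> :: complex assume \<mu>: "\<mu> \<noteq> 0"
    define S where "S = shift_op (\<lambda>x. T (P x)) \<mu>"
    have S: "bounded_op S" unfolding S_def by (rule bounded_op_shift[OF bounded_op_compose[OF T P]])
    have PS: "P (S x) = S (P x)" for x
      by (simp add: S_def shift_op_def bounded_op_diff[OF P] bounded_op_cscale[OF P] comm)
    have fr: "fredholm_on UNIV S" using R \<mu> by (simp add: riesz_on_def S_def)
    then obtain F where F: "finite F" "UNIV \<subseteq> range S + cspan F" by (auto simp: fredholm_on_iff)
    have "N \<subseteq> S ` N + cspan (P ` F)"
    proof
      fix y assume y: "y \<in> N"
      have "y \<in> range S + cspan F" using F(2) by blast
      then obtain a b where ab: "y = a + b" "a \<in> range S" "b \<in> cspan F" by (rule set_plus_elim)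
      obtain x where x: "a = S x" using ab(2) by blast
      have "y = S (P x) + P b" using y ab(1) x PS by (simp add: N_def bounded_op_add[OF P])
      moreover have "S (P x) \<in> S ` N" by (simp add: N_def idem)
      moreover have "P b \<in> cspan (P ` F)"
        using ab(3) F(1) module_hom.span_image[OF bounded_op_linear[OF P, unfolded linear_iff_module_hom], of F]
        by (simp add: cspan_eq_span)
      ultimately show "y \<in> S ` N + cspan (P ` F)" by (simp add: set_plus_intro)
    qed
    moreover have "P ` F \<subseteq> N" by (auto simp: N_def idem)
    moreover have "fin_dim (kernel_on N S)"
    proof (rule fin_dim_subset)
      show "fin_dim (kernel_on UNIV S)" using fr by (simp add: fredholm_on_iff)
      show "kernel_on N S \<subseteq> kernel_on UNIV S" by (auto simp: kernel_on_def)
    qed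
    moreover have "upper_semi_fredholm_on UNIV S"
      using fr by (simp add: fredholm_on_iff upper_semi_fredholm_on_def)
    then have "closed (S ` N)"
      using closed_subspace_image_upper_semi_fredholm[OF S UNIV _ N] by (simp add: closed_subspace_def)
    ultimately have "fredholm_on N S" using F(1) unfolding fredholm_on_iff by blast
    then show "fredholm_on N (shift_op T \<mu>)"
      using fredholm_on_cong[of N "shift_op T \<mu>" S] by (simp add: S_def shift_op_def N_def)
  qed
  then show ?thesis using red BM by blast
qed

theorem theorem2p7:
  fixes T :: "'a::complex_banach \<Rightarrow> 'a"
  assumes "\<not> fin_dim (UNIV :: 'a set)"
    and "bounded_op T"
  defines "c1 \<equiv> (\<exists>M N. reducing_pair T M N \<and> bounded_below_on M T \<and> riesz_on N T)"
    and "c2 \<equiv> admits_GKRD T \<and> 0 \<notin> interior (sigma_ap T)"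
    and "c3 \<equiv> admits_GKRD T \<and> SVEP_at T 0"
    and "c4 \<equiv> (\<exists>M N. reducing_pair T M N \<and> upper_semi_browder_on M T \<and> riesz_on N T)"
    and "c5 \<equiv> admits_GKRD T \<and> \<not> (0 islimpt sigma_B_plus T)"
    and "c6 \<equiv> admits_GKRD T \<and> 0 \<notin> interior (sigma_B_plus T)"
    and "c7 \<equiv> (\<exists>P. bounded_op P \<and> (\<forall>x. P (P x) = P x) \<and> (\<forall>x. P (T x) = T (P x)) \<and>
               upper_semi_browder_on UNIV (\<lambda>x. T x + P x) \<and> riesz_on UNIV (\<lambda>x. T (P x)))"
  shows "(c1 \<longleftrightarrow> c2) \<and> (c2 \<longleftrightarrow> c3) \<and> (c3 \<longleftrightarrow> c4) \<and> (c4 \<longleftrightarrow> c5) \<and> (c5 \<longleftrightarrow> c6) \<and> (c6 \<longleftrightarrow> c7)"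
proof -
  note T = \<open>bounded_op T\<close>
  have from_c1: "c2 \<and> c3 \<and> c4 \<and> c5" if c1
  proof -
    obtain M N where MN: "reducing_pair T M N" "bounded_below_on M T" "riesz_on N T"
      using \<open>c1\<close> unfolding c1_def by blast
    have M: "csubspace M" using MN(1) by (simp add: reducing_pair_def closed_subspace_def)
    have "kernel_on M T = {0}"
      using MN(2) inj_on_iff_kernel_on[OF T M] by (simp add: bounded_below_on_def)
    then have "kato_on M T"
      using MN(2) csubspace_image_funpow[OF T M] by (simp add: kato_on_def bounded_below_on_def csubspace_def)
    then have "admits_GKRD T" using MN unfolding admits_GKRD_def by blast
    moreover have "c4"
      using MN bounded_below_on_imp_upper_semi_browder_on[OF T M MN(2)] unfolding c4_def by blast
    ultimately show ?thesis
      using not_interior_sigma_ap[OF T MN] SVEP_at_zero[OF T MN] not_islimpt_sigma_B_plus[OF T MN]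
      by (simp add: c2_def c3_def c5_def)
  qed
  have c5_c6: "c6" if "c5"
  proof -
    have "0 islimpt sigma_B_plus T" if "0 \<in> interior (sigma_B_plus T)"
      using that interior_limit_point by blast
    then show ?thesis using \<open>c5\<close> by (auto simp: c5_def c6_def)
  qed
  have c4_c1: "c1" if "c4"
    using that bounded_below_riesz_of_browder_riesz[OF T] unfolding c1_def c4_def by blast
  have c4_c7: "c7" if "c4"
    using that projection_of_browder_riesz[OF T] unfolding c4_def c7_def by blast
  have c7_c4: "c4" if "c7"
    using that browder_riesz_of_projection[OF T] unfolding c4_def c7_def by blast
  \<comment> \<open>Shared by (ii) and (vi): both yield points arbitrarily near 0 where the shift is
    injective on the whole space, hence on M.\<close>
  have near_c1: "c1" if "admits_GKRD T" and near: "\<And>e. e > 0 \<Longrightarrow> \<exists>z. cmod z < e \<and> inj (shift_op T z)"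
  proof -
    obtain M N where MN: "reducing_pair T M N" "kato_on M T" "riesz_on N T"
      using \<open>admits_GKRD T\<close> unfolding admits_GKRD_def by blast
    have "\<exists>z. cmod z < e \<and> inj_on (shift_op T z) M" if "e > 0" for e
      using near[OF that] inj_on_subset by blast
    then show ?thesis
      using bounded_below_on_of_kato_on[OF T _ _ MN(2)] MN unfolding c1_def reducing_pair_def by blast
  qed
  have c2_c1: "c1" if c2: "c2"
  proof (rule near_c1)
    show "admits_GKRD T" using c2 by (simp add: c2_def)
    fix e :: real assume "e > 0"
    then obtain z where "z \<in> ball 0 e" "z \<notin> sigma_ap T"
      using c2 unfolding c2_def mem_interior by blast
    then show "\<exists>z. cmod z < e \<and> inj (shift_op T z)"
      by (intro exI[of _ z]) (simp add: sigma_ap_def bounded_below_on_def)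
  qed
  have c6_c1: "c1" if c6: "c6"
  proof (rule near_c1)
    show "admits_GKRD T" using c6 by (simp add: c6_def)
    fix e :: real assume e: "e > 0"
    \<comment> \<open>One half of e is spent on leaving the semi-Browder spectrum, the other on
      moving from there to an injective shift.\<close>
    then have "e / 2 > 0" by simp
    then obtain w where w: "w \<in> ball 0 (e / 2)" "w \<notin> sigma_B_plus T"
      using c6 unfolding c6_def mem_interior by blast
    have "closed_subspace (UNIV :: 'a set)" by (simp add: closed_subspace_def csubspace_def)
    moreover have "upper_semi_browder_on UNIV (shift_op T w)" using w(2) by (simp add: sigma_B_plus_def)
    ultimately obtain z where z: "cmod (z - w) < e / 2" "inj (shift_op T z)"
      using inj_on_near_upper_semi_browder[OF T _ subset_UNIV _ \<open>e / 2 > 0\<close>] by blast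
    have "cmod z < e" using norm_triangle_ineq[of "z - w" w] z(1) w(1) by simp
    then show "\<exists>z. cmod z < e \<and> inj (shift_op T z)" using z(2) by blast
  qed
  \<comment> \<open>The SVEP excludes analytic families of eigenvectors, which does not by itself
    name points with injective shifts; so the family from the Kato part is set against it directly
    instead of through \<open>near_c1\<close>.\<close>
  have c3_c1: "c1" if c3: "c3"
  proof -
    have svep: "SVEP_at T 0" using c3 by (simp add: c3_def)
    obtain M N where MN: "reducing_pair T M N" "kato_on M T" "riesz_on N T"
      using c3 unfolding c3_def admits_GKRD_def by blast
    have M: "closed_subspace M" "T ` M \<subseteq> M" using MN(1) by (simp_all add: reducing_pair_def)
    have "inj_on T M"
    proof (rule ccontr)
      assume "\<not> inj_on T M"
      then obtain r f where f: "r > 0" "c_analytic_on f (ball 0 r)"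
        "\<forall>z\<in>ball 0 r. f z \<in> M \<and> f z \<noteq> 0 \<and> shift_op T z (f z) = 0"
        using kato_eigenvector_family[OF T M MN(2)] by metis
      then have "\<forall>z\<in>ball 0 r. f z = 0" using svep unfolding SVEP_at_def by blast
      then show False using f(1,3) centre_in_ball by blast
    qed
    then have "bounded_below_on M T" using MN(2) by (simp add: kato_on_def bounded_below_on_def)
    then show ?thesis using MN unfolding c1_def by blast
  qed
  show ?thesis using from_c1 c5_c6 c4_c1 c4_c7 c7_c4 c2_c1 c6_c1 c3_c1 by blast
qed

end
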